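(* Let $\Phi$ be a point process on $\mathbb X$ with Papangelou intensity $c$, let $\beta:\mathbb X\to[0,1]$ be a measurable function and let $\beta\circ\Phi$ be the $\beta$-thinning of $\Phi$. Then $\beta\circ\Phi$ has a Papangelou intensity $c_\beta$ which satisfies, for any $x\in\mathbb X$, $$c_\beta(x,\beta\circ\Phi)=\beta(x)\,\mathbb E\big[c(x,\Phi)\,\big|\,\beta\circ\Phi\big]\quad\text{a.s.}$$
   Context: $\mathbb X$ is a locally compact metric space with its Borel $\sigma$-algebra, and $\ell$ is a Radon measure on $\mathbb X$ (not necessarily diffuse). $N_{\mathbb X}$ is the set of configurations, i.e. nonnegative-integer-valued measures on $\mathbb X$ finite on relatively compact Borel sets, with the smallest $\sigma$-algebra making $\phi\mapsto\phi(A)$ measurable for every relatively compact Borel $A$. Configurations are treated as (multi)sets of points: $\sum_{x\in\phi}f(x)=\int f\,\mathrm d\phi$, $\phi\setminus x=\phi-\delta_x$. A point process is a random element of $N_{\mathbb X}$. The $\beta$-thinning $\beta\circ\Phi$ is obtained from $\Phi$ by keeping, given $\Phi$, each point $x$ independently with probability $\beta(x)$ and deleting it otherwise. A (version of the) Papangelou intensity of a point process $\Psi$ is a measurable $c:\mathbb X\times N_{\mathbb X}\to\mathbb R_+$ such that for all measurable $u:\mathbb X\times N_{\mathbb X}\to\mathbb R_+$, $\mathbb E[\sum_{x\in\Psi}u(x,\Psi\setminus x)]=\int_{\mathbb X}\mathbb E[c(x,\Psi)u(x,\Psi)]\,\ell(\mathrm dx)$; versions are unique only up to $\ell\otimes\mathbb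 P_\Psi$-null sets, and the claim is that a suitable version $c_\beta$ exists.
   Formalization: The space is also assumed second countable (otherwise the total number of points is not measurable), and intensities may be infinite on a null set of the product of ℓ and the law of the process, since E[c(x,Φ)|β∘Φ] can be infinite at exceptional x. *)

theory Defs
  imports "HOL-Probability.Probability"
begin

definition radon_measure :: "'a::topological_space measure \<Rightarrow> bool" where
  "radon_measure l \<longleftrightarrow>
     sets l = sets borel \<and>
     (\<forall>K. compact K \<longrightarrow> emeasure l K < \<infinity>) \<and>
     (\<forall>A\<in>sets borel. emeasure l A = (INF U\<in>{U. open U \<and> A \<subseteq> U}. emeasure l U)) \<and>
     (\<forall>U. open U \<longrightarrow> emeasure l U = (SUP K\<in>{K. compact K \<and> K \<subseteq> U}. emeasure l K))"

definition relatively_compact_borel :: "'a::topological_space set set" where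
  "relatively_compact_borel = {A \<in> sets borel. compact (closure A)}"

text \<open>A configuration may have infinite total mass, so its values lie in the extended natural
  numbers; multiple points are allowed.\<close>

definition configurations :: "'a::topological_space measure set" where
  "configurations =
     {\<phi>. sets \<phi> = sets borel \<and>
         (\<forall>A\<in>sets borel. emeasure \<phi> A \<in> range ennreal_of_enat) \<and>
         (\<forall>A\<in>relatively_compact_borel. emeasure \<phi> A < \<infinity>)}"

definition config_space :: "'a::topological_space measure measure" where
  "config_space =
     (SUP A\<in>relatively_compact_borel. vimage_algebra configurations (\<lambda>\<phi>. emeasure \<phi> A) borel)"

definition point_process :: "'w measure \<Rightarrow> ('w \<Rightarrow> 'a::topological_space measure) \<Rightarrow> bool" where
  "point_process M \<Phi> \<longleftrightarrow> prob_space M \<and> \<Phi> \<in> M \<rightarrow>\<^sub>M config_space"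

text \<open>Only meaningful when \<open>\<phi>\<close> has an atom at \<open>x\<close>; it is only ever integrated in \<open>x\<close> against \<open>\<phi>\<close>.\<close>

definition remove_point :: "'a::topological_space measure \<Rightarrow> 'a \<Rightarrow> 'a measure" where
  "remove_point \<phi> x = diff_measure \<phi> (return borel x)"

text \<open>Intensities and test functions take values in \<open>[0, \<infinity>]\<close>. For test functions this is equivalent
  to using finite ones, by monotone convergence. An intensity is only determined up to null sets
  of the product of \<open>l\<close> and the law of \<open>\<Psi>\<close>, and is required to be finite outside such a set:
  a pointwise conditional expectation of a finite but non-integrable variable may be infinite.\<close>

definition papangelou_intensity ::
  "'w measure \<Rightarrow> 'a::topological_space measure \<Rightarrow> ('w \<Rightarrow> 'a measure)
     \<Rightarrow> ('a \<Rightarrow> 'a measure \<Rightarrow> ennreal) \<Rightarrow> bool" where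
  "papangelou_intensity M l \<Psi> c \<longleftrightarrow>
     (\<lambda>(x, \<phi>). c x \<phi>) \<in> borel_measurable (borel \<Otimes>\<^sub>M config_space) \<and>
     (AE x in l. AE \<omega> in M. c x (\<Psi> \<omega>) < \<infinity>) \<and>
     (\<forall>u \<in> borel_measurable (borel \<Otimes>\<^sub>M config_space).
        (\<integral>\<^sup>+\<omega>. (\<integral>\<^sup>+x. u (x, remove_point (\<Psi> \<omega>) x) \<partial>\<Psi> \<omega>) \<partial>M) =
        (\<integral>\<^sup>+x. (\<integral>\<^sup>+\<omega>. c x (\<Psi> \<omega>) * u (x, \<Psi> \<omega>) \<partial>M) \<partial>l))"

text \<open>The points of \<open>\<phi>\<close> listed with multiplicity: an atom of mass \<open>n\<close> at \<open>x\<close> contributes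
  \<open>(x, 0), \<dots>, (x, n - 1)\<close>.\<close>

definition points :: "'a::topological_space measure \<Rightarrow> ('a \<times> nat) set" where
  "points \<phi> = {(x, j). of_nat j < emeasure \<phi> {x}}"

definition kept_points ::
  "'a::topological_space measure \<Rightarrow> ('a \<times> nat \<Rightarrow> bool) \<Rightarrow> 'a measure" where
  "kept_points \<phi> \<kappa> = distr (count_space {p \<in> points \<phi>. \<kappa> p}) borel fst"

text \<open>The law of the \<open>\<beta>\<close>-thinning of a deterministic configuration.\<close>

definition thinning_law ::
  "('a::topological_space \<Rightarrow> real) \<Rightarrow> 'a measure \<Rightarrow> 'a measure measure" where
  "thinning_law \<beta> \<phi> =
     distr (\<Pi>\<^sub>M p\<in>points \<phi>. measure_pmf (bernoulli_pmf (\<beta> (fst p)))) config_space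
       (kept_points \<phi>)"

text \<open>\<open>\<Psi>\<close> is a version of the \<open>\<beta>\<close>-thinning of \<open>\<Phi>\<close>, defined on the same probability space: its
  conditional law given \<open>\<Phi>\<close> is \<open>thinning_law \<beta> \<Phi>\<close>.\<close>

definition is_thinning ::
  "'w measure \<Rightarrow> ('a::topological_space \<Rightarrow> real) \<Rightarrow> ('w \<Rightarrow> 'a measure) \<Rightarrow> ('w \<Rightarrow> 'a measure)
     \<Rightarrow> bool" where
  "is_thinning M \<beta> \<Phi> \<Psi> \<longleftrightarrow>
     point_process M \<Psi> \<and>
     (\<forall>D\<in>sets config_space. \<forall>B\<in>sets config_space.
        emeasure M {\<omega>\<in>space M. \<Phi> \<omega> \<in> D \<and> \<Psi> \<omega> \<in> B} =
        (\<integral>\<^sup>+\<omega>. indicator D (\<Phi> \<omega>) * emeasure (thinning_law \<beta> (\<Phi> \<omega>)) B \<partial>M))"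

end

theory Submission
  imports Defs
begin

text \<open>
  Let \<open>T \<phi>\<close> be the law of the thinning of a fixed configuration \<open>\<phi>\<close>. Since every point is kept
  independently, summing over the kept points gives the identity
  \<open>\<integral> \<Sum>x\<in>\<psi>. u (x, \<psi> - x) T \<phi> (d\<psi>) = \<Sum>x\<in>\<phi>. \<beta> x \<integral> u (x, \<psi>) T (\<phi> - x) (d\<psi>)\<close>. Averaging it over
  \<open>\<Phi>\<close> and applying the defining equation of \<open>c\<close> to the test function
  \<open>(x, \<phi>) \<mapsto> \<beta> x \<integral> u (x, \<psi>) T \<phi> (d\<psi>)\<close> shows that \<open>\<beta> x E[c (x, \<Phi>) | \<Psi>]\<close> is an intensity of \<open>\<Psi>\<close>.
  The remaining points are that the conditional expectations have a version that is jointly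
  measurable in \<open>x\<close> and \<open>\<Psi>\<close>, obtained by a monotone class argument, and that \<open>T\<close> is a measurable
  kernel, obtained from its Laplace functional.
\<close>

section \<open>Jointly measurable versions of conditional expectations\<close>

text \<open>No conditional law of \<open>\<Phi>\<close> given \<open>\<Psi>\<close> is used.
  Versions are built for product sets by Radon-Nikodym and carried through complements and limits;
  their exceptional null set may depend on \<open>x\<close>, which matches the quantifiers of the
  claim. Multiple points are handled by labels \<open>(x, j)\<close>, so that each unit of mass has
  its own coin. The price: passing from \<open>\<phi>\<close> to \<open>\<phi> - \<delta>_x\<close>
  drops the top label at \<open>x\<close>, while the sum over kept points deletes an arbitrary one.
  Thinning laws therefore have to be invariant under relabelling. The coin space depends on
  \<open>\<phi>\<close>, so measurability in \<open>\<phi>\<close> cannot be read off the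
  construction. The Laplace functional of the thinning at \<open>f\<close> is
  \<open>exp (- \<integral> h d\<phi>)\<close> with
  \<open>h = - ln (1 - \<beta> + \<beta> exp (- f))\<close>, in which no labels occur; exact counts
  are then recovered from it by a limit. An intensity must also be almost surely finite, although a
  conditional expectation of a finite variable may be infinite. Here the equation for
  \<open>\<Psi>\<close> itself forces finiteness, because configurations have finite mass on
  relatively compact sets.\<close>

lemma finite_measure_subalgebra_vimage:
  assumes "prob_space M" and \<Psi>: "\<Psi> \<in> M \<rightarrow>\<^sub>M N"
  shows "finite_measure_subalgebra M (vimage_algebra (space M) \<Psi> N)"
proof -
  interpret prob_space M by fact
  have "\<Psi> \<in> space M \<rightarrow> space N" using \<Psi> by (simp add: measurable_def)
  then have "subalgebra M (vimage_algebra (space M) \<Psi> N)"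
    using \<Psi> by (auto simp: subalgebra_def sets_vimage_algebra2 intro: measurable_sets)
  then show ?thesis by unfold_locales
qed

text \<open>Every event of the sigma-algebra generated by \<open>\<Psi>\<close> is a preimage
  \<open>{\<Psi> \<in> B}\<close>, so averages over such events determine the conditional
  expectation.\<close>

lemma nn_cond_exp_vimage_charact:
  assumes M: "prob_space M" and \<Psi>: "\<Psi> \<in> M \<rightarrow>\<^sub>M N"
    and "f \<in> borel_measurable M" and g: "g \<in> borel_measurable N"
    and eq: "\<And>B. B \<in> sets N \<Longrightarrow>
      (\<integral>\<^sup>+\<omega>. g (\<Psi> \<omega>) * indicator B (\<Psi> \<omega>) \<partial>M) = (\<integral>\<^sup>+\<omega>. f \<omega> * indicator B (\<Psi> \<omega>) \<partial>M)"
  shows "AE \<omega> in M. g (\<Psi> \<omega>) = nn_cond_exp M (vimage_algebra (space M) \<Psi> N) f \<omega>"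
proof -
  let ?F = "vimage_algebra (space M) \<Psi> N"
  interpret F: finite_measure_subalgebra M ?F
    by (rule finite_measure_subalgebra_vimage[OF M \<Psi>])
  have space: "\<Psi> \<in> space M \<rightarrow> space N" using \<Psi> by (simp add: measurable_def)
  show ?thesis
  proof (rule F.nn_cond_exp_charact)
    fix A assume "A \<in> sets ?F"
    then obtain B where B: "A = \<Psi> -` B \<inter> space M" "B \<in> sets N"
      using sets_vimage_algebra2[OF space] by auto
    have ind: "indicator A \<omega> = (indicator B (\<Psi> \<omega>) :: ennreal)" if "\<omega> \<in> space M" for \<omega>
      using that B by (auto simp: indicator_def)
    show "(\<integral>\<^sup>+\<omega>\<in>A. f \<omega> \<partial>M) = (\<integral>\<^sup>+\<omega>\<in>A. g (\<Psi> \<omega>) \<partial>M)"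
      using eq[OF B(2)] by (simp add: ind cong: nn_integral_cong_simp)
  next
    show "(\<lambda>\<omega>. g (\<Psi> \<omega>)) \<in> borel_measurable ?F"
      by (rule measurable_compose[OF measurable_vimage_algebra1[OF space] g])
  qed fact
qed

context
  fixes M :: "'w measure" and \<Phi> :: "'w \<Rightarrow> 'b" and \<Psi> :: "'w \<Rightarrow> 'c" and N N' and X :: "'x measure"
  assumes M: "prob_space M" and \<Phi>[measurable]: "\<Phi> \<in> M \<rightarrow>\<^sub>M N" and \<Psi>[measurable]: "\<Psi> \<in> M \<rightarrow>\<^sub>M N'"
begin

interpretation prob_space M by (rule M)

abbreviation (input) "cexp \<equiv> nn_cond_exp M (vimage_algebra (space M) \<Psi> N')"

interpretation F: finite_measure_subalgebra M "vimage_algebra (space M) \<Psi> N'"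
  by (rule finite_measure_subalgebra_vimage[OF M \<Psi>])

text \<open>The null set may depend on \<open>x\<close>; joint measurability of \<open>g\<close> is
  what the iterated integrals of the Papangelou equation require.\<close>

definition joint_version :: "('x \<times> 'b \<Rightarrow> ennreal) \<Rightarrow> ('x \<times> 'c \<Rightarrow> ennreal) \<Rightarrow> bool" where
  "joint_version h g \<longleftrightarrow> g \<in> borel_measurable (X \<Otimes>\<^sub>M N') \<and>
     (\<forall>x\<in>space X. AE \<omega> in M. g (x, \<Psi> \<omega>) = cexp (\<lambda>\<omega>. h (x, \<Phi> \<omega>)) \<omega>)"

lemma joint_versionI:
  assumes [measurable]: "g \<in> borel_measurable (X \<Otimes>\<^sub>M N')" "h \<in> borel_measurable (X \<Otimes>\<^sub>M N)"
    and "\<And>x B. x \<in> space X \<Longrightarrow> B \<in> sets N' \<Longrightarrow>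
      (\<integral>\<^sup>+\<omega>. g (x, \<Psi> \<omega>) * indicator B (\<Psi> \<omega>) \<partial>M) = (\<integral>\<^sup>+\<omega>. h (x, \<Phi> \<omega>) * indicator B (\<Psi> \<omega>) \<partial>M)"
  shows "joint_version h g"
  unfolding joint_version_def
proof (intro conjI ballI)
  fix x assume [measurable]: "x \<in> space X"
  show "AE \<omega> in M. g (x, \<Psi> \<omega>) = cexp (\<lambda>\<omega>. h (x, \<Phi> \<omega>)) \<omega>"
    by (rule nn_cond_exp_vimage_charact[OF M \<Psi>, where g="\<lambda>\<psi>. g (x, \<psi>)"])
      (auto simp: assms(3)[OF \<open>x \<in> space X\<close>])
qed fact

text \<open>A weight that depends on \<open>\<Psi>\<close> alone passes through the conditional
  expectation. Indicator weights serve the closure steps below; a section of the test function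
  serves the Papangelou equation.\<close>

lemma joint_version_integral:
  assumes v: "joint_version h g" and x[measurable]: "x \<in> space X"
    and [measurable]: "h \<in> borel_measurable (X \<Otimes>\<^sub>M N)" "v \<in> borel_measurable N'"
  shows "(\<integral>\<^sup>+\<omega>. v (\<Psi> \<omega>) * g (x, \<Psi> \<omega>) \<partial>M) = (\<integral>\<^sup>+\<omega>. v (\<Psi> \<omega>) * h (x, \<Phi> \<omega>) \<partial>M)"
proof -
  have "(\<integral>\<^sup>+\<omega>. v (\<Psi> \<omega>) * g (x, \<Psi> \<omega>) \<partial>M) = (\<integral>\<^sup>+\<omega>. v (\<Psi> \<omega>) * cexp (\<lambda>\<omega>. h (x, \<Phi> \<omega>)) \<omega> \<partial>M)"
    using v x unfolding joint_version_def by (intro nn_integral_cong_AE) auto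
  also have "\<dots> = (\<integral>\<^sup>+\<omega>. v (\<Psi> \<omega>) * h (x, \<Phi> \<omega>) \<partial>M)"
    using \<Psi> by (intro F.nn_cond_exp_intg measurable_compose[OF measurable_vimage_algebra1])
      (auto simp: measurable_def)
  finally show ?thesis .
qed

text \<open>The conditional probability of \<open>\<Phi> \<in> D\<close> as a function of the value
  of \<open>\<Psi>\<close> is the Radon-Nikodym density of
  \<open>\<mu> B = P(\<Phi> \<in> D, \<Psi> \<in> B)\<close> with respect to the law
  \<open>P\<close> of \<open>\<Psi>\<close>. On a product set the dependence on \<open>x\<close> is
  just the factor \<open>indicator A x\<close>.\<close>

lemma joint_version_indicator_times:
  assumes A[measurable]: "A \<in> sets X" and D[measurable]: "D \<in> sets N"
  shows "\<exists>g. joint_version (indicator (A \<times> D)) g"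
proof -
  define P where "P = distr M N' \<Psi>"
  define \<mu> where "\<mu> = distr (density M (\<lambda>\<omega>. indicator D (\<Phi> \<omega>))) N' \<Psi>"
  interpret P: prob_space P
    unfolding P_def by (rule prob_space_distr) fact
  have em: "emeasure \<mu> B = (\<integral>\<^sup>+\<omega>. indicator D (\<Phi> \<omega>) * indicator B (\<Psi> \<omega>) \<partial>M)" if "B \<in> sets N'" for B
    using that unfolding \<mu>_def
    by (subst emeasure_distr)
      (auto simp: emeasure_density indicator_def intro!: nn_integral_cong)
  have "absolutely_continuous P \<mu>"
    unfolding absolutely_continuous_def
  proof
    fix B assume B: "B \<in> null_sets P"
    then have [measurable]: "B \<in> sets N'" by (auto simp: P_def)
    have "emeasure \<mu> B \<le> (\<integral>\<^sup>+\<omega>. indicator B (\<Psi> \<omega>) \<partial>M)"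
      by (subst em) (auto intro!: nn_integral_mono simp: indicator_def)
    also have "\<dots> = emeasure P B"
      unfolding P_def by (simp add: nn_integral_distr flip: nn_integral_indicator)
    also have "\<dots> = 0" using B by auto
    finally show "B \<in> null_sets \<mu>" by (auto simp: null_sets_def \<mu>_def)
  qed
  moreover have "sets \<mu> = sets P" by (simp add: \<mu>_def P_def)
  ultimately obtain g where g: "g \<in> borel_measurable P" "density P g = \<mu>"
    using P.Radon_Nikodym by blast
  then have [measurable]: "g \<in> borel_measurable N'" by (simp add: P_def)
  have "joint_version (indicator (A \<times> D)) (\<lambda>(x, \<psi>). indicator A x * g \<psi>)"
  proof (rule joint_versionI)
    fix x B assume [measurable]: "x \<in> space X" "B \<in> sets N'"
    have "(\<integral>\<^sup>+\<omega>. g (\<Psi> \<omega>) * indicator B (\<Psi> \<omega>) \<partial>M) = emeasure (density P g) B"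
      by (subst emeasure_density) (auto simp: P_def nn_integral_distr)
    also have "\<dots> = (\<integral>\<^sup>+\<omega>. indicator D (\<Phi> \<omega>) * indicator B (\<Psi> \<omega>) \<partial>M)"
      by (simp add: g em)
    finally show "(\<integral>\<^sup>+\<omega>. (case (x, \<Psi> \<omega>) of (x, \<psi>) \<Rightarrow> indicator A x * g \<psi>) * indicator B (\<Psi> \<omega>) \<partial>M) =
      (\<integral>\<^sup>+\<omega>. indicator (A \<times> D) (x, \<Phi> \<omega>) * indicator B (\<Psi> \<omega>) \<partial>M)"
      by (simp add: indicator_times nn_integral_cmult mult.assoc)
  qed auto
  then show ?thesis by blast
qed

text \<open>Dynkin's pi-lambda argument from product sets. Disjoint unions are checked by
  integration; complements go through additivity of the conditional expectation, which avoids
  subtracting integrals in \<open>[0, \<infinity>]\<close>.\<close>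

lemma joint_version_indicator:
  assumes "S \<in> sets (X \<Otimes>\<^sub>M N)"
  shows "\<exists>g. joint_version (indicator S) g"
proof -
  let ?G = "{a \<times> b |a b. a \<in> sets X \<and> b \<in> sets N}"
  have "S \<in> sigma_sets (space X \<times> space N) ?G"
    using assms by (simp add: sets_pair_measure)
  with Int_stable_pair_measure_generator pair_measure_closed show ?thesis
  proof (induction S rule: sigma_sets_induct_disjoint)
    case (basic S)
    then show ?case using joint_version_indicator_times by auto
  next
    case empty
    show ?case using joint_version_indicator_times[OF sets.empty_sets sets.empty_sets] by (metis Times_empty)
  next
    case (compl S)
    then have S[measurable]: "S \<in> sets (X \<Otimes>\<^sub>M N)" by (simp add: sets_pair_measure)
    obtain g where g: "joint_version (indicator S) g" using compl.IH by auto
    then have [measurable]: "g \<in> borel_measurable (X \<Otimes>\<^sub>M N')" by (simp add: joint_version_def)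
    have "joint_version (indicator (space X \<times> space N - S)) (\<lambda>p. 1 - g p)"
      unfolding joint_version_def
    proof (intro conjI ballI)
      fix x assume x[measurable]: "x \<in> space X"
      let ?i = "\<lambda>\<omega>. indicator S (x, \<Phi> \<omega>) :: ennreal"
      let ?j = "\<lambda>\<omega>. indicator (space X \<times> space N - S) (x, \<Phi> \<omega>) :: ennreal"
      have [measurable]: "space X \<times> space N - S \<in> sets (X \<Otimes>\<^sub>M N)"
        using sets.compl_sets[OF S] by (simp add: space_pair_measure)
      have "AE \<omega> in M. cexp ?i \<omega> + cexp ?j \<omega> = cexp (\<lambda>\<omega>. ?i \<omega> + ?j \<omega>) \<omega>"
        by (rule F.nn_cond_exp_sum) auto
      moreover have "AE \<omega> in M. cexp (\<lambda>\<omega>. ?i \<omega> + ?j \<omega>) \<omega> = cexp (\<lambda>_. 1) \<omega>"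
        using x measurable_space[OF \<Phi>] by (intro F.nn_cond_exp_cong) (auto simp: indicator_def)
      moreover have "AE \<omega> in M. 1 = cexp (\<lambda>_. 1) \<omega>"
        by (rule F.nn_cond_exp_F_meas) auto
      moreover have "AE \<omega> in M. g (x, \<Psi> \<omega>) = cexp ?i \<omega>"
        using g x by (simp add: joint_version_def)
      ultimately show "AE \<omega> in M. 1 - g (x, \<Psi> \<omega>) = cexp ?j \<omega>"
      proof eventually_elim
        case (elim \<omega>)
        \<comment> \<open>The sum being 1, both terms are finite, so the second one can be
          cancelled.\<close>
        then have "g (x, \<Psi> \<omega>) + cexp ?j \<omega> = 1" by simp
        then show ?case
          by (metis add.commute ennreal_add_diff_cancel_right ennreal_one_neq_top ennreal_add_eq_top)
      qed
    qed auto
    then show ?case by blast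
  next
    case (union S)
    then have "\<forall>i. \<exists>g. joint_version (indicator (S i)) g" by auto
    then obtain g where g: "\<And>i. joint_version (indicator (S i)) (g i)" by metis
    have S[measurable]: "S i \<in> sets (X \<Otimes>\<^sub>M N)" for i using union by (auto simp: sets_pair_measure)
    have [measurable]: "g i \<in> borel_measurable (X \<Otimes>\<^sub>M N')" for i
      using g by (simp add: joint_version_def)
    have "joint_version (indicator (\<Union>i. S i)) (\<lambda>p. \<Sum>i. g i p)"
    proof (rule joint_versionI)
      fix x B assume x[measurable]: "x \<in> space X" and B[measurable]: "B \<in> sets N'"
      have "(\<integral>\<^sup>+\<omega>. (\<Sum>i. g i (x, \<Psi> \<omega>)) * indicator B (\<Psi> \<omega>) \<partial>M) =
          (\<Sum>i. \<integral>\<^sup>+\<omega>. indicator B (\<Psi> \<omega>) * g i (x, \<Psi> \<omega>) \<partial>M)"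
        by (subst nn_integral_suminf[symmetric]) (auto simp: mult.commute)
      also have "\<dots> = (\<Sum>i. \<integral>\<^sup>+\<omega>. indicator B (\<Psi> \<omega>) * indicator (S i) (x, \<Phi> \<omega>) \<partial>M)"
        by (subst joint_version_integral[OF g x]) auto
      also have "\<dots> = (\<integral>\<^sup>+\<omega>. (\<Sum>i. indicator (S i) (x, \<Phi> \<omega>)) * indicator B (\<Psi> \<omega>) \<partial>M)"
        by (subst nn_integral_suminf[symmetric]) (auto simp: mult.commute)
      finally show "(\<integral>\<^sup>+\<omega>. (\<Sum>i. g i (x, \<Psi> \<omega>)) * indicator B (\<Psi> \<omega>) \<partial>M) =
          (\<integral>\<^sup>+\<omega>. indicator (\<Union>i. S i) (x, \<Phi> \<omega>) * indicator B (\<Psi> \<omega>) \<partial>M)"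
        using union by (simp add: suminf_indicator)
    qed auto
    then show ?case by blast
  qed
qed

lemma joint_version_exists:
  assumes "h \<in> borel_measurable (X \<Otimes>\<^sub>M N)"
  shows "\<exists>g. joint_version h g"
  using assms
proof (induction rule: borel_measurable_induct)
  case (cong f g)
  obtain k where k: "joint_version g k" using cong(4) by blast
  have "f (x, \<Phi> \<omega>) = g (x, \<Phi> \<omega>)" if "x \<in> space X" "\<omega> \<in> space M" for x \<omega>
    using that cong measurable_space[OF \<Phi>] by (auto simp: space_pair_measure)
  then have "AE \<omega> in M. cexp (\<lambda>\<omega>. g (x, \<Phi> \<omega>)) \<omega> = cexp (\<lambda>\<omega>. f (x, \<Phi> \<omega>)) \<omega>" if [measurable]: "x \<in> space X" for x
    using that cong(1,2)[measurable] by (intro F.nn_cond_exp_cong) auto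
  then have "joint_version f k"
    using k unfolding joint_version_def by (force intro: AE_mp)
  then show ?case by blast
next
  case (set A)
  then show ?case by (rule joint_version_indicator)
next
  case (mult u c)
  note [measurable] = mult(2)
  obtain g where g: "joint_version u g" using mult by auto
  then have [measurable]: "g \<in> borel_measurable (X \<Otimes>\<^sub>M N')" by (simp add: joint_version_def)
  have "joint_version (\<lambda>p. c * u p) (\<lambda>p. c * g p)"
    using joint_version_integral[OF g, of _ "\<lambda>\<psi>. c * indicator _ \<psi>"]
    by (intro joint_versionI) (auto simp: ac_simps)
  then show ?case by blast
next
  case (add u v)
  note [measurable] = add(1,3)
  obtain g k where g: "joint_version u g" and k: "joint_version v k" using add by auto
  then have [measurable]: "g \<in> borel_measurable (X \<Otimes>\<^sub>M N')" "k \<in> borel_measurable (X \<Otimes>\<^sub>M N')"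
    by (simp_all add: joint_version_def)
  have "joint_version (\<lambda>p. v p + u p) (\<lambda>p. k p + g p)"
    using joint_version_integral[OF g, of _ "indicator _"] joint_version_integral[OF k, of _ "indicator _"]
    by (intro joint_versionI) (auto simp: distrib_left nn_integral_add mult.commute)
  then show ?case by blast
next
  case (seq U)
  note [measurable] = seq(1)
  obtain g where g: "\<And>i. joint_version (U i) (g i)" using seq by metis
  then have [measurable]: "g i \<in> borel_measurable (X \<Otimes>\<^sub>M N')" for i by (simp add: joint_version_def)
  have "joint_version (SUP i. U i) (\<lambda>p. SUP i. g i p)"
  proof (rule joint_versionI)
    fix x B assume x[measurable]: "x \<in> space X" and B[measurable]: "B \<in> sets N'"
    \<comment> \<open>The versions \<open>g i\<close> were chosen independently of each other, so
      they increase only almost surely, for each fixed \<open>x\<close>. Monotone convergence is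
      therefore applied in its almost everywhere form.\<close>
    have mono: "AE \<omega> in M. g i (x, \<Psi> \<omega>) \<le> g (Suc i) (x, \<Psi> \<omega>)" for i
    proof -
      have "AE \<omega> in M. cexp (\<lambda>\<omega>. U i (x, \<Phi> \<omega>)) \<omega> \<le> cexp (\<lambda>\<omega>. U (Suc i) (x, \<Phi> \<omega>)) \<omega>"
        using seq(3) by (intro F.nn_cond_exp_mono) (auto simp: incseq_Suc_iff le_fun_def)
      moreover have "AE \<omega> in M. g i (x, \<Psi> \<omega>) = cexp (\<lambda>\<omega>. U i (x, \<Phi> \<omega>)) \<omega>"
        "AE \<omega> in M. g (Suc i) (x, \<Psi> \<omega>) = cexp (\<lambda>\<omega>. U (Suc i) (x, \<Phi> \<omega>)) \<omega>"
        using g x by (simp_all add: joint_version_def)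
      ultimately show ?thesis by eventually_elim simp
    qed
    have "(\<integral>\<^sup>+\<omega>. (SUP i. g i (x, \<Psi> \<omega>)) * indicator B (\<Psi> \<omega>) \<partial>M) =
        (\<integral>\<^sup>+\<omega>. (SUP i. indicator B (\<Psi> \<omega>) * g i (x, \<Psi> \<omega>)) \<partial>M)"
      by (simp add: SUP_mult_left_ennreal mult.commute)
    also have "\<dots> = (SUP i. \<integral>\<^sup>+\<omega>. indicator B (\<Psi> \<omega>) * g i (x, \<Psi> \<omega>) \<partial>M)"
    proof (rule nn_integral_monotone_convergence_SUP_AE)
      show "AE \<omega> in M. indicator B (\<Psi> \<omega>) * g i (x, \<Psi> \<omega>) \<le> indicator B (\<Psi> \<omega>) * g (Suc i) (x, \<Psi> \<omega>)" for i
        using mono[of i] by eventually_elim (auto intro: mult_left_mono)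
    qed auto
    also have "\<dots> = (SUP i. \<integral>\<^sup>+\<omega>. indicator B (\<Psi> \<omega>) * U i (x, \<Phi> \<omega>) \<partial>M)"
      by (subst joint_version_integral[OF g x]) auto
    also have "\<dots> = (\<integral>\<^sup>+\<omega>. (SUP i. indicator B (\<Psi> \<omega>) * U i (x, \<Phi> \<omega>)) \<partial>M)"
      using seq(3)
      by (intro nn_integral_monotone_convergence_SUP[symmetric])
        (auto simp: incseq_def le_fun_def intro!: mult_left_mono)
    finally show "(\<integral>\<^sup>+\<omega>. (SUP i. g i (x, \<Psi> \<omega>)) * indicator B (\<Psi> \<omega>) \<partial>M) =
        (\<integral>\<^sup>+\<omega>. (SUP i. U i) (x, \<Phi> \<omega>) * indicator B (\<Psi> \<omega>) \<partial>M)"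
      by (simp add: SUP_mult_left_ennreal mult.commute image_comp)
  qed (auto simp: SUP_apply[abs_def] image_comp)
  then show ?case by blast
qed

end

section \<open>The space of configurations\<close>

lemma configurationsD:
  assumes "\<phi> \<in> configurations"
  shows sets_configuration: "sets \<phi> = sets borel"
    and configuration_enat: "A \<in> sets borel \<Longrightarrow> emeasure \<phi> A \<in> range ennreal_of_enat"
    and configuration_finite: "A \<in> relatively_compact_borel \<Longrightarrow> emeasure \<phi> A < \<infinity>"
  using assms by (auto simp: configurations_def)

lemma empty_relatively_compact_borel: "{} \<in> relatively_compact_borel"
  by (simp add: relatively_compact_borel_def)

lemma space_config_space: "space config_space = configurations"
  unfolding config_space_def using empty_relatively_compact_borel
  by (auto simp: space_Sup_eq_UN)

lemma measurable_config_spaceI: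
  assumes "\<And>z. z \<in> space N \<Longrightarrow> f z \<in> configurations"
    and "\<And>A. A \<in> relatively_compact_borel \<Longrightarrow> (\<lambda>z. emeasure (f z) A) \<in> borel_measurable N"
  shows "f \<in> N \<rightarrow>\<^sub>M config_space"
  unfolding config_space_def
  using assms empty_relatively_compact_borel
  by (intro measurable_SUP2 measurable_vimage_algebra2) auto

lemma measurable_emeasure_config:
  assumes "A \<in> relatively_compact_borel"
  shows "(\<lambda>\<phi>. emeasure \<phi> A) \<in> borel_measurable config_space"
  unfolding config_space_def
  by (rule measurable_SUP1[OF assms]) (auto intro: measurable_vimage_algebra1)

lemma configuration_nat:
  assumes "\<phi> \<in> configurations" "A \<in> relatively_compact_borel"
  shows "\<exists>n::nat. emeasure \<phi> A = of_nat n"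
proof -
  have "A \<in> sets borel" using assms by (simp add: relatively_compact_borel_def)
  then obtain e where e: "emeasure \<phi> A = ennreal_of_enat e"
    using configuration_enat[OF assms(1)] by blast
  then show ?thesis
    using configuration_finite[OF assms] by (cases e) auto
qed

lemma measurable_config_sections:
  assumes "\<Theta> \<in> N \<rightarrow>\<^sub>M config_space" "z \<in> space N"
  shows "\<Theta> z \<in> configurations" "sets (\<Theta> z) = sets borel"
  using measurable_space[OF assms] sets_configuration by (auto simp: space_config_space)

text \<open>An increasing exhaustion by relatively compact open sets stands in for the topological
  hypothesis.\<close>

locale exhaustion =
  fixes K :: "nat \<Rightarrow> 'a::{metric_space, second_countable_topology} set"
  assumes open_K: "\<And>n. open (K n)" and compact_K: "\<And>n. compact (closure (K n))"
    and incseq_K: "incseq K" and Union_K: "(\<Union>n. K n) = UNIV"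

text \<open>Local compactness gives every point an open neighbourhood with compact closure, and
  Lindelof reduces this cover to a countable one. The finite unions of an enumeration increase and
  stay relatively compact.\<close>

lemma exhaustion_exists:
  assumes lc: "locally compact (UNIV :: 'a::{metric_space, second_countable_topology} set)"
  shows "\<exists>K :: nat \<Rightarrow> 'a set. exhaustion K"
proof -
  let ?\<U> = "{U::'a set. open U \<and> compact (closure U)}"
  obtain \<V> where V: "\<V> \<subseteq> ?\<U>" "countable \<V>" "\<Union>\<V> = \<Union>?\<U>"
    using Lindelof[of ?\<U>] by auto
  have "\<exists>U\<in>?\<U>. x \<in> U" for x :: 'a
  proof -
    have "\<exists>U C. openin (top_of_set UNIV) U \<and> compact C \<and> x \<in> U \<and> U \<subseteq> C \<and> C \<subseteq> (UNIV::'a set)"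
      using lc unfolding locally_def by (metis UNIV_I openin_open_trans open_UNIV openin_subtopology_self subtopology_UNIV open_openin)
    then obtain U C where U: "open U" "compact C" "x \<in> U" "U \<subseteq> C" by auto
    then have "closure U \<subseteq> C" by (simp add: closure_minimal compact_imp_closed)
    then have "compact (closure U)"
      using compact_Int_closed[OF U(2) closed_closure, of U] by (simp add: Int_absorb1)
    with U show ?thesis by auto
  qed
  with V have cov: "\<Union>\<V> = UNIV" by blast
  then have ne: "\<V> \<noteq> {}" by auto
  define W where "W = from_nat_into \<V>"
  have W: "range W = \<V>" using ne V by (simp add: W_def range_from_nat_into)
  define K where "K n = (\<Union>i\<le>n. W i)" for n
  have Wp: "open (W i)" "compact (closure (W i))" for i using W V by auto
  have "exhaustion K"
  proof
    show "open (K n)" for n unfolding K_def using Wp by auto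
    show "compact (closure (K n))" for n
      unfolding K_def using Wp by (induction n) (auto simp: atMost_Suc closure_Un)
    show "incseq K" unfolding K_def incseq_def by (auto intro: order_trans)
    show "(\<Union>n. K n) = UNIV" unfolding K_def using cov W by blast
  qed
  then show ?thesis by blast
qed

section \<open>Measurable dependence of integrals against a configuration\<close>

context exhaustion
begin

lemma K_borel[measurable]: "K n \<in> sets borel"
  using open_K by auto

lemma K_relatively_compact: "K n \<in> relatively_compact_borel"
  using compact_K by (simp add: relatively_compact_borel_def)

lemma relatively_compact_Int_K:
  assumes "A \<in> sets borel" shows "A \<inter> K n \<in> relatively_compact_borel"
proof -
  have "closure (A \<inter> K n) \<subseteq> closure (K n)" by (rule closure_mono) auto
  then have "compact (closure (A \<inter> K n))"
    by (metis closed_closure compact_Int_closed compact_K inf.absorb_iff2)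
  with assms show ?thesis by (auto simp: relatively_compact_borel_def)
qed

lemma in_K: "\<exists>n. x \<in> K n" using Union_K by blast

lemma SUP_indicator_K: "(SUP n. indicator (K n) x :: ennreal) = 1"
proof (rule antisym)
  obtain n where "x \<in> K n" using in_K by blast
  then show "1 \<le> (SUP n. indicator (K n) x :: ennreal)"
    by (intro SUP_upper2[of n]) auto
qed (auto intro!: SUP_least simp: indicator_def)

lemma nn_integral_SUP_K:
  assumes s: "sets \<phi> = sets borel" and [measurable]: "f \<in> borel_measurable borel"
  shows "(\<integral>\<^sup>+x. f x \<partial>\<phi>) = (SUP n. \<integral>\<^sup>+x. f x * indicator (K n) x \<partial>\<phi>)"
proof -
  note [measurable_cong] = s
  have "(\<integral>\<^sup>+x. f x \<partial>\<phi>) = (\<integral>\<^sup>+x. (SUP n. f x * indicator (K n) x) \<partial>\<phi>)"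
    by (simp add: SUP_indicator_K flip: SUP_mult_left_ennreal)
  also have "\<dots> = (SUP n. \<integral>\<^sup>+x. f x * indicator (K n) x \<partial>\<phi>)"
    using incseq_K
    by (intro nn_integral_monotone_convergence_SUP)
      (auto simp: incseq_def le_fun_def indicator_def subset_eq)
  finally show ?thesis .
qed

text \<open>Pi-lambda argument from product sets. The cut-off to \<open>K n\<close> makes the mass
  finite, which the subtraction in the complement step needs; a configuration as a whole may have
  infinite mass.\<close>

lemma emeasure_section_measurable:
  assumes \<Theta>: "\<Theta> \<in> N \<rightarrow>\<^sub>M config_space" and S: "S \<in> sets (N \<Otimes>\<^sub>M borel)"
  shows "(\<lambda>z. \<integral>\<^sup>+y. indicator S (z, y) * indicator (K n) y \<partial>\<Theta> z) \<in> borel_measurable N"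
proof -
  let ?G = "{a \<times> b |a b. a \<in> sets N \<and> b \<in> sets borel}"
  let ?f = "\<lambda>S z. \<integral>\<^sup>+y. indicator S (z, y) * indicator (K n) y \<partial>\<Theta> z"
  have [measurable]: "(\<lambda>z. emeasure (\<Theta> z) (b \<inter> K n)) \<in> borel_measurable N" if "b \<in> sets borel" for b
    by (rule measurable_compose[OF \<Theta> measurable_emeasure_config[OF relatively_compact_Int_K[OF that]]])
  have "S \<in> sigma_sets (space N \<times> space borel) ?G"
    using S by (simp only: sets_pair_measure)
  with Int_stable_pair_measure_generator pair_measure_closed show ?thesis
  proof (induction S rule: sigma_sets_induct_disjoint)
    case (basic S)
    then obtain a b where ab[measurable]: "S = a \<times> b" "a \<in> sets N" "b \<in> sets borel" by auto
    have "?f S z = indicator a z * emeasure (\<Theta> z) (b \<inter> K n)" if "z \<in> space N" for z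
    proof -
      note [measurable_cong] = measurable_config_sections(2)[OF \<Theta> that]
      have "?f S z = (\<integral>\<^sup>+y. indicator a z * indicator (b \<inter> K n) y \<partial>\<Theta> z)"
        by (intro nn_integral_cong) (auto simp: ab indicator_def)
      then show ?thesis by (simp add: nn_integral_cmult)
    qed
    then show ?case by (subst measurable_cong) auto
  next
    case empty
    show ?case by simp
  next
    case (compl S)
    then have S: "S \<in> sets (N \<Otimes>\<^sub>M borel)" by (simp only: sets_pair_measure)
    have "?f (space N \<times> space borel - S) z = emeasure (\<Theta> z) (UNIV \<inter> K n) - ?f S z" if z[measurable]: "z \<in> space N" for z
    proof -
      note [measurable_cong] = measurable_config_sections(2)[OF \<Theta> that]
      note [measurable] = S
      have fin: "emeasure (\<Theta> z) (K n) < \<infinity>"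
        by (rule configuration_finite[OF measurable_config_sections(1)[OF \<Theta> z] K_relatively_compact])
      have "?f (space N \<times> space borel - S) z = (\<integral>\<^sup>+y. indicator (K n) y - indicator S (z, y) * indicator (K n) y \<partial>\<Theta> z)"
        using z by (intro nn_integral_cong) (auto simp: indicator_def)
      also have "\<dots> = (\<integral>\<^sup>+y. indicator (K n) y \<partial>\<Theta> z) - ?f S z"
      proof (rule nn_integral_diff)
        have "?f S z \<le> (\<integral>\<^sup>+y. indicator (K n) y \<partial>\<Theta> z)"
          by (intro nn_integral_mono) (auto simp: indicator_def)
        also have "\<dots> = emeasure (\<Theta> z) (K n)" by simp
        finally show "?f S z \<noteq> \<infinity>" using fin by auto
      qed (auto simp: indicator_def)
      finally show ?thesis by simp
    qed
    note eq = this
    note compl.IH[measurable]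
    show ?case by (rule measurable_cong[THEN iffD2, OF eq]) measurable
  next
    case (union S)
    have S: "S i \<in> sets (N \<Otimes>\<^sub>M borel)" for i using union by (auto simp only: sets_pair_measure)
    have "?f (\<Union>i. S i) z = (\<Sum>i. ?f (S i) z)" if z[measurable]: "z \<in> space N" for z
    proof -
      note [measurable_cong] = measurable_config_sections(2)[OF \<Theta> that]
      note [measurable] = S
      show ?thesis
        using union by (subst nn_integral_suminf[symmetric]) (auto simp: suminf_indicator)
    qed
    with union.IH show ?case by (subst measurable_cong) auto
  qed
qed

text \<open>A measurable configuration-valued map acts as a kernel, possibly of infinite mass. For
  indicators the integral is the supremum over \<open>n\<close> of the truncated ones; the rest is
  the usual induction over nonnegative functions.\<close>

lemma nn_integral_config_measurable:
  fixes h :: "'z \<times> 'a \<Rightarrow> ennreal"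
  assumes \<Theta>: "\<Theta> \<in> N \<rightarrow>\<^sub>M config_space" and h: "h \<in> borel_measurable (N \<Otimes>\<^sub>M borel)"
  shows "(\<lambda>z. \<integral>\<^sup>+y. h (z, y) \<partial>\<Theta> z) \<in> borel_measurable N"
  using h
proof (induction rule: borel_measurable_induct)
  case (cong f g)
  have "(\<integral>\<^sup>+y. f (z, y) \<partial>\<Theta> z) = (\<integral>\<^sup>+y. g (z, y) \<partial>\<Theta> z)" if "z \<in> space N" for z
    using cong that by (intro nn_integral_cong) (auto simp: space_pair_measure)
  then show ?case using cong(4) by (rule measurable_cong[THEN iffD2])
next
  case (set S)
  have "(\<integral>\<^sup>+y. indicator S (z, y) \<partial>\<Theta> z) = (SUP n. \<integral>\<^sup>+y. indicator S (z, y) * indicator (K n) y \<partial>\<Theta> z)"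
    if "z \<in> space N" for z
    using that set[measurable] measurable_config_sections(2)[OF \<Theta> that] by (intro nn_integral_SUP_K) auto
  note eq = this
  show ?case using emeasure_section_measurable[OF \<Theta> set] by (intro measurable_cong[THEN iffD2, OF eq]) auto
next
  case (mult u c)
  have "(\<integral>\<^sup>+y. c * u (z, y) \<partial>\<Theta> z) = c * (\<integral>\<^sup>+y. u (z, y) \<partial>\<Theta> z)" if [measurable]: "z \<in> space N" for z
  proof -
    note [measurable_cong] = measurable_config_sections(2)[OF \<Theta> that]
    show ?thesis using mult(2)[measurable] by (intro nn_integral_cmult) auto
  qed
  note eq = this
  show ?case using mult by (intro measurable_cong[THEN iffD2, OF eq]) auto
next
  case (add u v)
  have "(\<integral>\<^sup>+y. v (z, y) + u (z, y) \<partial>\<Theta> z) = (\<integral>\<^sup>+y. v (z, y) \<partial>\<Theta> z) + (\<integral>\<^sup>+y. u (z, y) \<partial>\<Theta> z)" if [measurable]: "z \<in> space N" for z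
  proof -
    note [measurable_cong] = measurable_config_sections(2)[OF \<Theta> that]
    show ?thesis using add(1,3)[measurable] by (intro nn_integral_add) auto
  qed
  note eq = this
  show ?case using add by (intro measurable_cong[THEN iffD2, OF eq]) auto
next
  case (seq U)
  have "(\<integral>\<^sup>+y. (SUP i. U i) (z, y) \<partial>\<Theta> z) = (SUP i. \<integral>\<^sup>+y. U i (z, y) \<partial>\<Theta> z)" if [measurable]: "z \<in> space N" for z
  proof -
    note [measurable_cong] = measurable_config_sections(2)[OF \<Theta> that]
    have "(\<integral>\<^sup>+y. (SUP i. U i (z, y)) \<partial>\<Theta> z) = (SUP i. \<integral>\<^sup>+y. U i (z, y) \<partial>\<Theta> z)"
      using seq(1)[measurable] seq(3)
      by (intro nn_integral_monotone_convergence_SUP) (auto simp: incseq_def le_fun_def)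
    then show ?thesis by (simp add: image_comp)
  qed
  note eq = this
  show ?case using seq by (intro measurable_cong[THEN iffD2, OF eq]) (auto simp: image_comp)
qed

lemma nn_integral_config_measurable':
  fixes h :: "'z \<Rightarrow> 'a \<Rightarrow> ennreal"
  assumes "\<Theta> \<in> N \<rightarrow>\<^sub>M config_space" "(\<lambda>(z, y). h z y) \<in> borel_measurable (N \<Otimes>\<^sub>M borel)"
  shows "(\<lambda>z. \<integral>\<^sup>+y. h z y \<partial>\<Theta> z) \<in> borel_measurable N"
  using nn_integral_config_measurable[OF assms] by simp

lemma emeasure_config_measurable[measurable]:
  assumes "A \<in> sets (borel :: 'a measure)"
  shows "(\<lambda>\<phi>. emeasure \<phi> A) \<in> borel_measurable config_space"
proof -
  have "(\<lambda>\<phi>. \<integral>\<^sup>+y. indicator A (snd (\<phi>, y)) \<partial>\<phi>) \<in> borel_measurable config_space"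
    using nn_integral_config_measurable[of "\<lambda>\<phi>. \<phi>" config_space "\<lambda>(\<phi>, y). indicator A y"] assms by simp
  moreover have "(\<integral>\<^sup>+y. indicator A (snd (\<phi>, y)) \<partial>\<phi>) = emeasure \<phi> A" if "\<phi> \<in> space config_space" for \<phi>
    using that assms by (auto simp: space_config_space sets_configuration)
  ultimately show ?thesis by (simp cong: measurable_cong_simp)
qed

text \<open>The mass at \<open>x\<close> is the integral over \<open>y\<close> of the indicator of
  the diagonal, written as \<open>dist x y = 0\<close>; this makes it measurable in the point and
  the configuration together.\<close>

lemma emeasure_singleton_measurable:
  "(\<lambda>(x :: 'a, \<phi>). emeasure \<phi> {x}) \<in> borel_measurable (borel \<Otimes>\<^sub>M config_space)"
proof -
  have [measurable]: "(\<lambda>(z, y). of_bool (dist (fst z :: 'a) y = 0) :: ennreal)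
      \<in> borel_measurable ((borel \<Otimes>\<^sub>M (config_space :: 'a measure measure)) \<Otimes>\<^sub>M borel)"
    by measurable
  have "(\<lambda>z. \<integral>\<^sup>+y. of_bool (dist (fst z :: 'a) y = 0) \<partial>snd z)
      \<in> borel_measurable (borel \<Otimes>\<^sub>M config_space)"
    by (rule nn_integral_config_measurable') measurable
  moreover have "(\<integral>\<^sup>+y. of_bool (dist (fst z) y = 0) \<partial>snd z) = (case z of (x, \<phi>) \<Rightarrow> emeasure \<phi> {x})"
    if "z \<in> space (borel \<Otimes>\<^sub>M config_space)" for z :: "'a \<times> 'a measure"
  proof -
    obtain x \<phi> where z: "z = (x, \<phi>)" by (cases z)
    with that have s: "sets \<phi> = sets borel" by (auto simp: space_pair_measure space_config_space sets_configuration)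
    have "(\<integral>\<^sup>+y. of_bool (dist x y = 0) \<partial>\<phi>) = (\<integral>\<^sup>+y. indicator {x} y \<partial>\<phi>)"
      by (intro nn_integral_cong) (auto simp: indicator_def)
    then show ?thesis using s z by simp
  qed
  ultimately show ?thesis by (simp cong: measurable_cong_simp)
qed

end

section \<open>Configurations as labelled point sets\<close>

text \<open>Counting measure on the labels, projected to the base points. Both the kept part of a
  configuration and the configuration itself are of this form.\<close>

definition labelled_config :: "('a::topological_space \<times> nat) set \<Rightarrow> 'a measure" where
  "labelled_config I = distr (count_space I) borel fst"

definition locally_finite :: "('a::topological_space \<times> nat) set \<Rightarrow> bool" where
  "locally_finite I \<longleftrightarrow> (\<forall>A\<in>relatively_compact_borel. finite {p \<in> I. fst p \<in> A})"

lemma locally_finite_subset: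
  fixes I J :: "('a::topological_space \<times> nat) set"
  shows "locally_finite I \<Longrightarrow> J \<subseteq> I \<Longrightarrow> locally_finite J"
  unfolding locally_finite_def
proof
  fix A :: "'a set"
  assume I: "\<forall>A\<in>relatively_compact_borel. finite {p \<in> I. fst p \<in> A}" and "J \<subseteq> I" "A \<in> relatively_compact_borel"
  then have "{p \<in> J. fst p \<in> A} \<subseteq> {p \<in> I. fst p \<in> A}" "finite {p \<in> I. fst p \<in> A}" by auto
  then show "finite {p \<in> J. fst p \<in> A}" by (rule finite_subset)
qed

lemma sets_labelled_config[simp, measurable_cong]: "sets (labelled_config I) = sets borel"
  and space_labelled_config[simp]: "space (labelled_config I) = UNIV"
  by (simp_all add: labelled_config_def)

lemma kept_points_eq: "kept_points \<phi> \<kappa> = labelled_config {p \<in> points \<phi>. \<kappa> p}"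
  by (simp add: kept_points_def labelled_config_def)

lemma emeasure_labelled_config:
  assumes "A \<in> sets borel"
  shows "emeasure (labelled_config I) A = emeasure (count_space I) {p \<in> I. fst p \<in> A}"
  unfolding labelled_config_def using assms
  by (subst emeasure_distr) (auto intro!: arg_cong[where f="emeasure _"])

lemma nn_integral_labelled_config:
  assumes "f \<in> borel_measurable borel"
  shows "(\<integral>\<^sup>+x. f x \<partial>labelled_config I) = (\<integral>\<^sup>+p. f (fst p) \<partial>count_space I)"
  unfolding labelled_config_def using assms by (subst nn_integral_distr) auto

lemma labelled_config_in_configurations:
  assumes "locally_finite I"
  shows "labelled_config I \<in> configurations"
  unfolding configurations_def
proof (intro CollectI conjI ballI)
  fix A :: "'a set" assume "A \<in> sets borel"
  show "emeasure (labelled_config I) A \<in> range ennreal_of_enat"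
  proof (cases "finite {p \<in> I. fst p \<in> A}")
    case True
    then show ?thesis
      using \<open>A \<in> sets borel\<close>
      by (intro range_eqI[of _ _ "enat (card {p \<in> I. fst p \<in> A})"])
        (auto simp: emeasure_labelled_config emeasure_count_space_finite)
  next
    case False
    then show ?thesis
      using \<open>A \<in> sets borel\<close>
      by (intro range_eqI[of _ _ "\<infinity>"])
        (auto simp: emeasure_labelled_config emeasure_count_space_infinite)
  qed
next
  fix A :: "'a set" assume A: "A \<in> relatively_compact_borel"
  then have "A \<in> sets borel" by (simp add: relatively_compact_borel_def)
  with assms A show "emeasure (labelled_config I) A < \<infinity>"
    by (auto simp: emeasure_labelled_config emeasure_count_space_finite locally_finite_def of_nat_less_top)
qed simp

lemma emeasure_labelled_config_insert:
  assumes "p \<notin> I" "A \<in> sets borel"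
  shows "emeasure (labelled_config (insert p I)) A = emeasure (labelled_config I) A + indicator A (fst p)"
proof -
  have "emeasure (labelled_config (insert p I)) A = (\<integral>\<^sup>+q. indicator A (fst q) \<partial>count_space (insert p I))"
    using assms(2) by (simp flip: nn_integral_labelled_config)
  also have "\<dots> = (\<integral>\<^sup>+q. indicator A (fst q) \<partial>count_space I) + indicator A (fst p)"
  proof -
    have "(\<integral>\<^sup>+q. indicator A (fst q) \<partial>count_space (insert p I)) =
        (\<integral>\<^sup>+q. indicator A (fst q) * indicator I q + indicator A (fst q) * indicator {p} q \<partial>count_space UNIV)"
      using assms(1) by (subst nn_integral_count_space_indicator) (auto simp: indicator_def intro!: nn_integral_cong)
    also have "\<dots> = (\<integral>\<^sup>+q. indicator A (fst q) \<partial>count_space I) + (\<integral>\<^sup>+q. indicator A (fst q) \<partial>count_space {p})"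
      by (subst nn_integral_add) (auto simp: nn_integral_count_space_indicator)
    finally show ?thesis by (simp add: nn_integral_count_space_finite)
  qed
  also have "(\<integral>\<^sup>+q. indicator A (fst q) \<partial>count_space I) = emeasure (labelled_config I) A"
    using assms(2) by (simp flip: nn_integral_labelled_config)
  finally show ?thesis .
qed

text \<open>\<open>diff_measure\<close> is defined from the setwise difference of two measures. Here
  that difference is the measure of \<open>I - {p}\<close>: adding \<open>p\<close> adds
  \<open>indicator A (fst p)\<close>, which is finite and so cancels.\<close>

lemma remove_point_labelled_config:
  assumes "p \<in> I"
  shows "remove_point (labelled_config I) (fst p) = labelled_config (I - {p})"
proof -
  have eq: "emeasure (labelled_config I) A - emeasure (return borel (fst p)) A = emeasure (labelled_config (I - {p})) A"
    if "A \<in> sets borel" for A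
  proof -
    have "emeasure (labelled_config I) A = emeasure (labelled_config (I - {p})) A + indicator A (fst p)"
      using emeasure_labelled_config_insert[of p "I - {p}" A] assms that by (simp add: insert_absorb)
    moreover have "indicator A (fst p) \<noteq> (top :: ennreal)" by (simp add: indicator_def)
    ultimately show ?thesis
      using that by simp
  qed
  have "remove_point (labelled_config I) (fst p) =
      measure_of UNIV (sets borel) (emeasure (labelled_config (I - {p})))"
    unfolding remove_point_def diff_measure_def
    using eq by (auto intro!: measure_of_eq simp: sets.sigma_sets_eq[of borel, simplified] simp del: emeasure_return)
  also have "\<dots> = labelled_config (I - {p})"
    using measure_of_of_measure[of "labelled_config (I - {p})"] by simp
  finally show ?thesis .
qed

section \<open>Configurations as sums of point masses, and removal of one point\<close>

context exhaustion
begin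

lemma singleton_relatively_compact: "{x::'a} \<in> relatively_compact_borel"
  by (simp add: relatively_compact_borel_def)

text \<open>Balls shrinking to \<open>x\<close> have masses tending to the mass of
  \<open>{x}\<close>, which is 0. Masses are integers, so some ball already has mass 0. Intersecting
  with \<open>K n\<close> supplies the finite mass that continuity from above needs.\<close>

lemma null_neighbourhood:
  fixes x :: 'a
  assumes \<phi>: "\<phi> \<in> configurations" and x: "emeasure \<phi> {x} = 0"
  shows "\<exists>U. open U \<and> x \<in> U \<and> emeasure \<phi> U = 0"
proof -
  obtain n where n: "x \<in> K n" using in_K by blast
  define B where "B i = ball x (1 / real (Suc i)) \<inter> K n" for i
  have B: "open (B i)" "x \<in> B i" "B i \<in> relatively_compact_borel" for i
    unfolding B_def using n open_K by (auto intro!: relatively_compact_Int_K)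
  have "(\<lambda>i. emeasure \<phi> (B i)) \<longlonglongrightarrow> emeasure \<phi> (\<Inter>i. B i)"
  proof (rule Lim_emeasure_decseq)
    show "range B \<subseteq> sets \<phi>" using B sets_configuration[OF \<phi>] by auto
    have "1 / real (Suc j) \<le> 1 / real (Suc i)" if "i \<le> j" for i j
      using that by (auto simp: field_simps)
    then show "decseq B" unfolding B_def decseq_def
      by (meson Int_mono subset_ball subset_refl)
    show "emeasure \<phi> (B i) \<noteq> \<infinity>" for i
      using configuration_finite[OF \<phi> B(3)[of i]] by auto
  qed
  moreover have "(\<Inter>i. B i) = {x}"
  proof -
    have "y = x" if "\<forall>i. dist x y < 1 / real (Suc i)" for y
    proof (rule ccontr)
      assume "y \<noteq> x"
      then obtain i where "1 / real (Suc i) < dist x y"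
        using nat_approx_posE[of "dist x y"] by auto
      with that show False by (meson less_asym)
    qed
    then show ?thesis using n unfolding B_def by auto
  qed
  ultimately have "(\<lambda>i. emeasure \<phi> (B i)) \<longlonglongrightarrow> 0" using x by simp
  then have "eventually (\<lambda>i. emeasure \<phi> (B i) < 1) sequentially"
    by (rule order_tendstoD) simp
  then obtain i where "emeasure \<phi> (B i) < 1"
    by (auto simp: eventually_sequentially)
  moreover obtain m :: nat where "emeasure \<phi> (B i) = of_nat m"
    using configuration_nat[OF \<phi> B(3)] by blast
  ultimately have "emeasure \<phi> (B i) = 0"
    by (cases m) auto
  with B show ?thesis by blast
qed

text \<open>By Lindelof, countably many open null sets already cover all points that are not
  atoms.\<close>

lemma non_atoms_null:
  assumes \<phi>: "\<phi> \<in> configurations"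
  shows "AE x in \<phi>. emeasure \<phi> {x::'a} \<noteq> 0"
proof -
  obtain \<V> where V: "\<V> \<subseteq> {U. open U \<and> emeasure \<phi> U = 0}" "countable \<V>" "\<Union>\<V> = \<Union>{U. open U \<and> emeasure \<phi> U = 0}"
    using Lindelof[of "{U. open U \<and> emeasure \<phi> U = 0}"] by auto
  have "(\<Union>U\<in>\<V>. U) \<in> null_sets \<phi>"
    using V by (intro null_sets_UN') (auto simp: null_sets_def sets_configuration[OF \<phi>])
  then have "AE x in \<phi>. x \<notin> \<Union>\<V>"
    by (intro AE_not_in) simp
  moreover have "x \<in> \<Union>\<V>" if "emeasure \<phi> {x} = 0" for x
    using null_neighbourhood[OF \<phi> that] V(3) by blast
  ultimately show ?thesis by (auto elim!: eventually_mono)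
qed

lemma locally_finite_countable:
  fixes I :: "('a \<times> nat) set"
  assumes "locally_finite I" shows "countable I"
proof -
  have "I \<subseteq> (\<Union>n. {p \<in> I. fst p \<in> K n})" using in_K by auto
  moreover have "countable (\<Union>n. {p \<in> I. fst p \<in> K n})"
    using assms K_relatively_compact by (intro countable_UN) (auto simp: locally_finite_def intro: countable_finite)
  ultimately show ?thesis by (rule countable_subset)
qed

text \<open>Over a point \<open>x\<close> there are exactly \<open>k x\<close> labels,
  \<open>k x\<close> being the mass at \<open>x\<close>. A finite set of labels over
  \<open>A\<close> thus has at most as many elements as the mass of its base points, hence at most
  \<open>m\<close>.\<close>

lemma locally_finite_points:
  fixes \<phi> :: "'a measure"
  assumes \<phi>: "\<phi> \<in> configurations" shows "locally_finite (points \<phi>)"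
  unfolding locally_finite_def
proof
  fix A :: "'a set" assume A: "A \<in> relatively_compact_borel"
  then have Ab: "A \<in> sets borel" by (simp add: relatively_compact_borel_def)
  obtain m :: nat where m: "emeasure \<phi> A = of_nat m" using configuration_nat[OF \<phi> A] by blast
  have "\<forall>x. \<exists>n::nat. emeasure \<phi> {x} = of_nat n"
    using configuration_nat[OF \<phi> singleton_relatively_compact] by blast
  then obtain k :: "'a \<Rightarrow> nat" where k: "\<And>x. emeasure \<phi> {x} = of_nat (k x)" by metis
  have "card F \<le> m" if F: "F \<subseteq> {p \<in> points \<phi>. fst p \<in> A}" "finite F" for F
  proof -
    have "F \<subseteq> Sigma (fst ` F) (\<lambda>x. {..<k x})"
      using F by (force simp: points_def k)
    then have "card F \<le> card (Sigma (fst ` F) (\<lambda>x. {..<k x}))"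
      using F by (intro card_mono) auto
    also have "\<dots> = (\<Sum>x\<in>fst ` F. k x)" using F by simp
    finally have "of_nat (card F) \<le> (of_nat (\<Sum>x\<in>fst ` F. k x) :: ennreal)" by (simp only: of_nat_le_iff)
    also have "\<dots> = emeasure \<phi> (fst ` F)"
      using F by (subst emeasure_eq_sum_singleton) (auto simp: k sets_configuration[OF \<phi>])
    also have "\<dots> \<le> emeasure \<phi> A"
      using F Ab by (intro emeasure_mono) (auto simp: sets_configuration[OF \<phi>])
    finally show ?thesis by (simp add: m)
  qed
  then show "finite {p \<in> points \<phi>. fst p \<in> A}"
    by (intro finite_if_finite_subsets_card_bdd[of _ m, THEN conjunct1]) auto
qed

text \<open>Both measures live on the countable set of atoms, and at an atom of mass
  \<open>n\<close> the labels \<open>0, ..., n - 1\<close> reproduce that mass.\<close>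

lemma labelled_config_points:
  fixes \<phi> :: "'a measure"
  assumes \<phi>: "\<phi> \<in> configurations" shows "labelled_config (points \<phi>) = \<phi>"
proof (rule measure_eqI)
  show "sets (labelled_config (points \<phi>)) = sets \<phi>" by (simp add: sets_configuration[OF \<phi>])
  fix A assume "A \<in> sets (labelled_config (points \<phi>))"
  then have A: "A \<in> sets borel" by simp
  let ?D = "fst ` points \<phi>"
  have D: "countable ?D" using locally_finite_countable[OF locally_finite_points[OF \<phi>]] by simp
  have D_iff: "x \<in> ?D \<longleftrightarrow> emeasure \<phi> {x} \<noteq> 0" for x
  proof -
    have "x \<in> ?D \<longleftrightarrow> (\<exists>j::nat. of_nat j < emeasure \<phi> {x})"
      by (auto simp: points_def image_iff)
    also have "\<dots> \<longleftrightarrow> 0 < emeasure \<phi> {x}"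
      by (metis of_nat_0 le_less_trans zero_le)
    finally show ?thesis by (simp add: zero_less_iff_neq_zero)
  qed
  have AD: "A \<inter> ?D \<in> sets borel" using A D by (auto intro: sets.countable)
  have "emeasure \<phi> A = emeasure \<phi> (A \<inter> ?D)"
    using non_atoms_null[OF \<phi>] A AD
    by (intro emeasure_eq_AE) (auto simp: D_iff sets_configuration[OF \<phi>])
  also have "\<dots> = (\<integral>\<^sup>+x. emeasure \<phi> {x} \<partial>count_space (A \<inter> ?D))"
    using D by (intro emeasure_countable_singleton) (auto simp: sets_configuration[OF \<phi>])
  also have "\<dots> = (\<integral>\<^sup>+x. emeasure (labelled_config (points \<phi>)) {x} \<partial>count_space (A \<inter> ?D))"
  proof (rule nn_integral_cong)
    fix x
    obtain n :: nat where n: "emeasure \<phi> {x} = of_nat n"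
      using configuration_nat[OF \<phi> singleton_relatively_compact] by blast
    have "{p \<in> points \<phi>. fst p \<in> {x}} = {x} \<times> {..<n}" by (auto simp: points_def n)
    moreover have "{x} \<times> {..<n} \<subseteq> points \<phi>" by (auto simp: points_def n)
    ultimately show "emeasure \<phi> {x} = emeasure (labelled_config (points \<phi>)) {x}"
      by (simp add: emeasure_labelled_config n emeasure_count_space_finite)
  qed
  also have "\<dots> = emeasure (labelled_config (points \<phi>)) (A \<inter> ?D)"
    using D by (intro emeasure_countable_singleton[symmetric]) auto
  also have "\<dots> = emeasure (labelled_config (points \<phi>)) A"
    using A AD by (auto simp: emeasure_labelled_config intro!: arg_cong[where f="emeasure _"])
  finally show "emeasure (labelled_config (points \<phi>)) A = emeasure \<phi> A" by simp
qed

lemma remove_point_eq: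
  fixes \<phi> :: "'a measure"
  assumes \<phi>: "\<phi> \<in> configurations" and p: "p \<in> points \<phi>"
  shows "remove_point \<phi> (fst p) = labelled_config (points \<phi> - {p})"
  using remove_point_labelled_config[OF p] by (simp add: labelled_config_points[OF \<phi>])

text \<open>An atom always carries the label \<open>(x, 0)\<close>; deleting that label realises the
  subtraction of the unit mass at \<open>x\<close>, so the result is again given by a locally finite
  set of labels.\<close>

lemma emeasure_remove_point:
  fixes \<phi> :: "'a measure"
  assumes \<phi>: "\<phi> \<in> configurations" and x: "emeasure \<phi> {x} \<noteq> 0"
  shows remove_point_in_configurations: "remove_point \<phi> x \<in> configurations"
    and "A \<in> sets borel \<Longrightarrow> emeasure (remove_point \<phi> x) A = emeasure \<phi> A - indicator A x"
proof -
  have p: "(x, 0) \<in> points \<phi>"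
    using x by (auto simp: points_def zero_less_iff_neq_zero)
  show "remove_point \<phi> x \<in> configurations"
    using remove_point_eq[OF \<phi> p] locally_finite_subset[OF locally_finite_points[OF \<phi>]]
    by (auto intro!: labelled_config_in_configurations)
  assume A: "A \<in> sets borel"
  have eq: "emeasure \<phi> A = emeasure (remove_point \<phi> x) A + indicator A x"
    using emeasure_labelled_config_insert[of "(x, 0)" "points \<phi> - {(x, 0)}" A] p A remove_point_eq[OF \<phi> p]
    by (simp add: insert_absorb labelled_config_points[OF \<phi>])
  have "indicator A x \<noteq> (top :: ennreal)" by (simp add: indicator_def)
  then show "emeasure (remove_point \<phi> x) A = emeasure \<phi> A - indicator A x"
    using ennreal_add_diff_cancel_right[of "indicator A x" "emeasure (remove_point \<phi> x) A"] eq by argo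
qed

text \<open>The labels at \<open>x\<close> are those below its mass, so lowering the mass from
  \<open>n + 1\<close> to \<open>n\<close> drops the top label \<open>n\<close>, whichever label was
  meant to be deleted. \<open>labelled_thinning_remove\<close> makes up for this mismatch.\<close>

lemma points_remove_point:
  fixes \<phi> :: "'a measure"
  assumes \<phi>: "\<phi> \<in> configurations" and n: "emeasure \<phi> {x} = of_nat (Suc n)"
  shows "points (remove_point \<phi> x) = points \<phi> - {(x, n)}"
proof -
  have "emeasure (remove_point \<phi> x) {y} = emeasure \<phi> {y} - indicator {y} x" for y
    using n by (intro emeasure_remove_point(2)[OF \<phi>]) (simp_all del: of_nat_Suc)
  then have *: "emeasure (remove_point \<phi> x) {y} = (if y = x then of_nat n else emeasure \<phi> {y})" for y
  proof (cases "y = x")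
    case True
    have "of_nat (Suc n) - 1 = (of_nat n :: ennreal)"
      using ennreal_add_diff_cancel_right[of 1 "of_nat n"] by (simp add: add.commute)
    with True n show ?thesis by (simp add: \<open>\<And>y. emeasure (remove_point \<phi> x) {y} = _\<close> del: of_nat_Suc)
  qed (simp add: \<open>\<And>y. emeasure (remove_point \<phi> x) {y} = _\<close>)
  show ?thesis
  proof (rule set_eqI)
    fix p :: "'a \<times> nat"
    obtain y j where p: "p = (y, j)" by (cases p)
    have "of_nat j < (of_nat n :: ennreal) \<longleftrightarrow> of_nat j < (of_nat (Suc n) :: ennreal) \<and> j \<noteq> n"
      by (simp only: of_nat_less_iff) auto
    then show "p \<in> points (remove_point \<phi> x) \<longleftrightarrow> p \<in> points \<phi> - {(x, n)}"
      by (cases "y = x") (simp_all add: p points_def * n del: of_nat_Suc)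
  qed
qed

text \<open>\<open>remove_point\<close> is only controlled at atoms, so it is replaced by the empty configuration elsewhere.\<close>

definition remove_atom :: "'a measure \<Rightarrow> 'a \<Rightarrow> 'a measure" where
  "remove_atom \<phi> x = (if emeasure \<phi> {x} = 0 then null_measure borel else remove_point \<phi> x)"

lemma remove_atom_measurable_pair:
  "(\<lambda>(x, \<phi>). remove_atom \<phi> x) \<in> (borel \<Otimes>\<^sub>M config_space) \<rightarrow>\<^sub>M config_space"
proof (rule measurable_config_spaceI)
  fix z :: "'a \<times> 'a measure" assume "z \<in> space (borel \<Otimes>\<^sub>M config_space)"
  moreover have "null_measure borel \<in> (configurations :: 'a measure set)"
    by (auto simp: configurations_def intro!: image_eqI[of _ _ 0])
  ultimately show "(case z of (x, \<phi>) \<Rightarrow> remove_atom \<phi> x) \<in> configurations"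
    by (auto simp: space_pair_measure space_config_space remove_atom_def remove_point_in_configurations)
next
  fix A :: "'a set" assume "A \<in> relatively_compact_borel"
  then have A[measurable]: "A \<in> sets borel" by (simp add: relatively_compact_borel_def)
  note [measurable] = emeasure_singleton_measurable[unfolded split_beta']
  have "(\<lambda>z. if emeasure (snd z) {fst z} = 0 then 0 else emeasure (snd z) A - indicator A (fst z))
      \<in> borel_measurable (borel \<Otimes>\<^sub>M config_space)"
    by measurable
  then show "(\<lambda>z. emeasure (case z of (x, \<phi>) \<Rightarrow> remove_atom \<phi> x) A) \<in> borel_measurable (borel \<Otimes>\<^sub>M config_space)"
  proof (rule measurable_cong[THEN iffD2, rotated])
    fix z :: "'a \<times> 'a measure" assume z: "z \<in> space (borel \<Otimes>\<^sub>M config_space)"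
    obtain x \<phi> where [simp]: "z = (x, \<phi>)" by (cases z)
    have \<phi>: "\<phi> \<in> configurations" using z by (simp add: space_pair_measure space_config_space)
    show "emeasure (case z of (x, \<phi>) \<Rightarrow> remove_atom \<phi> x) A =
     (if emeasure (snd z) {fst z} = 0 then 0 else emeasure (snd z) A - indicator A (fst z))"
      using emeasure_remove_point(2)[OF \<phi> _ A] by (simp add: remove_atom_def)
  qed
qed

lemma remove_atom_measurable[measurable]:
  assumes "f \<in> N \<rightarrow>\<^sub>M borel" "g \<in> N \<rightarrow>\<^sub>M config_space"
  shows "(\<lambda>z. remove_atom (g z) (f z)) \<in> N \<rightarrow>\<^sub>M config_space"
  using measurable_compose[OF measurable_Pair[OF assms] remove_atom_measurable_pair] by simp

text \<open>The two removals differ only at points that are not atoms, and those form a null set of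
  the configuration.\<close>

lemma nn_integral_remove_point:
  assumes \<phi>: "\<phi> \<in> configurations"
  shows "(\<integral>\<^sup>+x. u (x, remove_point \<phi> x) \<partial>\<phi>) = (\<integral>\<^sup>+x. u (x, remove_atom \<phi> x) \<partial>\<phi>)"
  using non_atoms_null[OF \<phi>] by (intro nn_integral_cong_AE) (auto simp: remove_atom_def)

lemma nn_integral_remove_atom_measurable:
  assumes u: "u \<in> borel_measurable (borel \<Otimes>\<^sub>M config_space)"
  shows "(\<lambda>\<phi>. \<integral>\<^sup>+x. u (x, remove_atom \<phi> x) \<partial>\<phi>) \<in> borel_measurable config_space"
proof (rule nn_integral_config_measurable')
  show "(\<lambda>(\<phi>, x). u (x, remove_atom \<phi> x)) \<in> borel_measurable (config_space \<Otimes>\<^sub>M borel)"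
    unfolding split_beta'
    by (rule measurable_compose[OF _ u])
      (intro measurable_Pair remove_atom_measurable measurable_fst measurable_snd)
qed simp

end

section \<open>The Mecke identity for thinnings\<close>

locale thinning = exhaustion K
  for K :: "nat \<Rightarrow> 'a::{metric_space, second_countable_topology} set" +
  fixes \<beta> :: "'a \<Rightarrow> real"
  assumes \<beta>_measurable[measurable]: "\<beta> \<in> borel_measurable borel"
    and \<beta>_nonneg[simp]: "\<And>x. 0 \<le> \<beta> x" and \<beta>_le_1[simp]: "\<And>x. \<beta> x \<le> 1"
begin

abbreviation coins :: "('a \<times> nat) set \<Rightarrow> ('a \<times> nat \<Rightarrow> bool) measure" where
  "coins I \<equiv> \<Pi>\<^sub>M p\<in>I. measure_pmf (bernoulli_pmf (\<beta> (fst p)))"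

text \<open>Allows any set of labels, because \<open>points \<phi> - {p}\<close> need not be the set
  of points of a configuration: deleting a lower label at a multiple point leaves a gap.\<close>

definition labelled_thinning :: "('a \<times> nat) set \<Rightarrow> 'a measure measure" where
  "labelled_thinning I = distr (coins I) config_space (\<lambda>\<kappa>. labelled_config {p \<in> I. \<kappa> p})"

lemma thinning_law_eq: "thinning_law \<beta> \<phi> = labelled_thinning (points \<phi>)"
  unfolding thinning_law_def labelled_thinning_def by (simp add: kept_points_eq[abs_def])

lemma coin_borel_measurable:
  fixes I :: "('a \<times> nat) set" and f :: "bool \<Rightarrow> 'b::topological_space"
  assumes "p \<in> I"
  shows "(\<lambda>\<kappa>. f (\<kappa> p)) \<in> borel_measurable (coins I)"
  by (rule measurable_compose[OF measurable_component_singleton[OF assms]]) simp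

lemma prob_space_coins: "prob_space (coins I)"
  by (intro prob_space_PiM) (simp add: measure_pmf.prob_space_axioms)

text \<open>Only finitely many labels lie over a relatively compact set, so a count is a finite sum
  of coins. Measurability on the possibly infinite coin product thus reduces to single
  coordinates.\<close>

lemma emeasure_kept:
  fixes I :: "('a \<times> nat) set"
  assumes "locally_finite I" "A \<in> relatively_compact_borel"
  shows "emeasure (labelled_config {p \<in> I. \<kappa> p}) A = (\<Sum>p\<in>{p \<in> I. fst p \<in> A}. of_bool (\<kappa> p))"
proof -
  let ?J = "{p \<in> I. fst p \<in> A}"
  have fin: "finite ?J" using assms by (simp add: locally_finite_def)
  have A: "A \<in> sets borel" using assms by (simp add: relatively_compact_borel_def)
  have "{p \<in> {p \<in> I. \<kappa> p}. fst p \<in> A} = {p \<in> ?J. \<kappa> p}" by auto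
  then have "emeasure (labelled_config {p \<in> I. \<kappa> p}) A = emeasure (count_space {p \<in> I. \<kappa> p}) {p \<in> ?J. \<kappa> p}"
    using A by (simp only: emeasure_labelled_config)
  also have "\<dots> = of_nat (card {p \<in> ?J. \<kappa> p})"
    using finite_subset[OF _ fin, of "{p \<in> ?J. \<kappa> p}"] by (intro emeasure_count_space_finite) auto
  also have "\<dots> = (\<Sum>p\<in>?J. of_bool (\<kappa> p))"
    using fin by (simp add: of_bool_def sum.If_cases Int_def)
  finally show ?thesis .
qed

lemma labelled_config_measurable:
  fixes I :: "('a \<times> nat) set"
  assumes "locally_finite I" "J \<subseteq> I"
  shows "(\<lambda>\<kappa>. labelled_config {p \<in> J. \<kappa> p}) \<in> coins I \<rightarrow>\<^sub>M config_space"
proof (rule measurable_config_spaceI)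
  have J: "locally_finite J" using assms by (rule locally_finite_subset)
  fix \<kappa> :: "'a \<times> nat \<Rightarrow> bool"
  show "labelled_config {p \<in> J. \<kappa> p} \<in> configurations"
    by (intro labelled_config_in_configurations locally_finite_subset[OF J]) auto
next
  have J: "locally_finite J" using assms by (rule locally_finite_subset)
  fix A :: "'a set" assume A: "A \<in> relatively_compact_borel"
  show "(\<lambda>\<kappa>. emeasure (labelled_config {p \<in> J. \<kappa> p}) A) \<in> borel_measurable (coins I)"
    unfolding emeasure_kept[OF J A] using assms(2)
    by (intro borel_measurable_sum coin_borel_measurable) auto
qed

lemma prob_space_labelled_thinning:
  "locally_finite I \<Longrightarrow> prob_space (labelled_thinning I)"
  unfolding labelled_thinning_def
  by (intro prob_space.prob_space_distr prob_space_coins labelled_config_measurable) auto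

lemma sets_labelled_thinning[simp, measurable_cong]: "sets (labelled_thinning I) = sets config_space"
  by (simp add: labelled_thinning_def)

text \<open>A label influences the law only through its base point, which fixes both the bias of its
  coin and the place of its mass. A bijection that preserves base points carries one coin product to
  the other and leaves the kept configuration unchanged.\<close>

lemma labelled_thinning_reindex:
  fixes I J :: "('a \<times> nat) set"
  assumes I: "locally_finite I" and J: "locally_finite J"
    and \<sigma>: "bij_betw \<sigma> I J" "\<And>p. p \<in> I \<Longrightarrow> fst (\<sigma> p) = fst p"
  shows "labelled_thinning I = labelled_thinning J"
proof -
  let ?t = "\<lambda>\<omega>. \<lambda>p\<in>I. \<omega> (\<sigma> p)"
  have PiM_eq: "coins I = (\<Pi>\<^sub>M p\<in>I. measure_pmf (bernoulli_pmf (\<beta> (fst (\<sigma> p)))))"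
    by (intro PiM_cong) (auto simp: \<sigma>)
  have coins: "coins I = distr (coins J) (coins I) ?t"
    unfolding PiM_eq using \<sigma>(1)
    by (intro distr_PiM_reindex[symmetric])
      (auto simp: bij_betw_def measure_pmf.prob_space_axioms)
  have t: "?t \<in> coins J \<rightarrow>\<^sub>M coins I"
    using bij_betwE[OF \<sigma>(1)]
    by (intro measurable_restrict) (auto intro!: measurable_compose[OF measurable_component_singleton])
  have lab: "labelled_config {p \<in> I. ?t \<omega> p} = labelled_config {q \<in> J. \<omega> q}" for \<omega>
  proof (rule measure_eqI)
    fix A assume "A \<in> sets (labelled_config {p \<in> I. ?t \<omega> p})"
    then have A: "A \<in> sets borel" by simp
    have bij: "bij_betw \<sigma> {p \<in> I. \<omega> (\<sigma> p)} {q \<in> J. \<omega> q}"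
      using \<sigma>(1) by (force simp: bij_betw_def inj_on_def)
    have "emeasure (labelled_config {p \<in> I. ?t \<omega> p}) A =
        (\<integral>\<^sup>+p. indicator A (fst p) \<partial>count_space {p \<in> I. ?t \<omega> p})"
      using A by (simp flip: nn_integral_labelled_config)
    also have "\<dots> = (\<integral>\<^sup>+p. indicator A (fst p) \<partial>count_space {p \<in> I. \<omega> (\<sigma> p)})"
      by (intro arg_cong[where f="\<lambda>S. \<integral>\<^sup>+p. _ p \<partial>count_space S"]) auto
    also have "(\<integral>\<^sup>+p. indicator A (fst p) \<partial>count_space {p \<in> I. \<omega> (\<sigma> p)}) =
        (\<integral>\<^sup>+p. indicator A (fst (\<sigma> p)) \<partial>count_space {p \<in> I. \<omega> (\<sigma> p)})"
      by (intro nn_integral_cong) (auto simp: \<sigma>)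
    also have "\<dots> = (\<integral>\<^sup>+q. indicator A (fst q) \<partial>count_space {q \<in> J. \<omega> q})"
      by (rule nn_integral_bij_count_space[OF bij])
    also have "\<dots> = emeasure (labelled_config {q \<in> J. \<omega> q}) A"
      using A by (simp flip: nn_integral_labelled_config)
    finally show "emeasure (labelled_config {p \<in> I. ?t \<omega> p}) A = emeasure (labelled_config {q \<in> J. \<omega> q}) A" .
  qed simp
  have "labelled_thinning I = distr (distr (coins J) (coins I) ?t) config_space (\<lambda>\<kappa>. labelled_config {p \<in> I. \<kappa> p})"
    unfolding labelled_thinning_def by (subst coins) (rule refl)
  also have "\<dots> = distr (coins J) config_space (\<lambda>\<omega>. labelled_config {p \<in> I. ?t \<omega> p})"
    by (subst distr_distr[OF labelled_config_measurable[OF I order_refl] t]) (simp add: comp_def)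
  also have "\<dots> = labelled_thinning J"
    unfolding lab labelled_thinning_def ..
  finally show ?thesis .
qed

lemma coin_times_measurable:
  fixes I :: "('a \<times> nat) set"
  assumes I: "locally_finite I" and p: "p \<in> I" and G: "G \<in> borel_measurable config_space"
  shows "(\<lambda>\<kappa>. (of_bool (\<kappa> p) :: ennreal) * G (labelled_config {q \<in> I - {p}. \<kappa> q})) \<in> borel_measurable (coins I)"
    (is "(\<lambda>\<kappa>. _ * ?g \<kappa>) \<in> _")
proof -
  have "?g \<in> borel_measurable (coins I)"
    by (rule measurable_compose[OF labelled_config_measurable[OF I Diff_subset] G])
  then show ?thesis
    using coin_borel_measurable[OF p, of of_bool] by (rule borel_measurable_times_ennreal[rotated])
qed

text \<open>The coin of \<open>p\<close> is independent of all others, and the argument of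
  \<open>G\<close> does not look at it. Its expectation \<open>\<beta> (fst p)\<close> therefore
  factors out.\<close>

lemma nn_integral_coin_split:
  fixes I :: "('a \<times> nat) set"
  assumes I: "locally_finite I" and p: "p \<in> I" and G: "G \<in> borel_measurable config_space"
  shows "(\<integral>\<^sup>+\<kappa>. of_bool (\<kappa> p) * G (labelled_config {q \<in> I - {p}. \<kappa> q}) \<partial>coins I) =
    ennreal (\<beta> (fst p)) * (\<integral>\<^sup>+\<psi>. G \<psi> \<partial>labelled_thinning (I - {p}))"
proof -
  let ?J = "I - {p}"
  let ?B = "measure_pmf (bernoulli_pmf (\<beta> (fst p)))"
  let ?f = "\<lambda>\<kappa>. of_bool (\<kappa> p) * G (labelled_config {q \<in> ?J. \<kappa> q})"
  have ins: "insert p ?J = I" using p by auto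
  interpret J: prob_space "coins ?J" by (rule prob_space_coins)
  \<comment> \<open>The coin product over \<open>I\<close> is obtained by inserting an independent
    coin at \<open>p\<close> into the product over \<open>I - {p}\<close>.\<close>
  have dis: "distr (?B \<Otimes>\<^sub>M coins ?J) (coins I) (\<lambda>(b, X). X(p := b)) = coins I"
    using distr_pair_PiM_eq_PiM[of ?J "\<lambda>p. measure_pmf (bernoulli_pmf (\<beta> (fst p)))" p]
    unfolding ins by (simp add: measure_pmf.prob_space_axioms)
  have upd: "(\<lambda>(b, X). X(p := b)) \<in> (?B \<Otimes>\<^sub>M coins ?J) \<rightarrow>\<^sub>M coins I"
    using measurable_fun_upd[of I ?J p snd "?B \<Otimes>\<^sub>M coins ?J" "\<lambda>p. measure_pmf (bernoulli_pmf (\<beta> (fst p)))" fst] p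
    by (auto simp: split_beta')
  have f: "?f \<in> borel_measurable (coins I)"
    by (rule coin_times_measurable[OF I p G])
  have "(\<integral>\<^sup>+\<kappa>. ?f \<kappa> \<partial>coins I) = (\<integral>\<^sup>+z. ?f ((\<lambda>(b, X). X(p := b)) z) \<partial>(?B \<Otimes>\<^sub>M coins ?J))"
    by (subst dis[symmetric], rule nn_integral_distr[OF upd]) (use f in simp)
  also have "\<dots> = (\<integral>\<^sup>+b. \<integral>\<^sup>+X. ?f (X(p := b)) \<partial>coins ?J \<partial>?B)"
    using measurable_compose[OF upd f] by (subst J.nn_integral_fst[symmetric]) (auto simp: split_beta')
  also have "\<dots> = (\<integral>\<^sup>+b. of_bool b * (\<integral>\<^sup>+\<psi>. G \<psi> \<partial>labelled_thinning ?J) \<partial>?B)"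
  proof (rule nn_integral_cong)
    fix b
    have J: "locally_finite ?J" using I by (rule locally_finite_subset) auto
    have eq: "{q \<in> ?J. (X(p := b)) q} = {q \<in> ?J. X q}" for X by auto
    have "(\<integral>\<^sup>+X. ?f (X(p := b)) \<partial>coins ?J) = (\<integral>\<^sup>+X. of_bool b * G (labelled_config {q \<in> ?J. X q}) \<partial>coins ?J)"
      unfolding eq by simp
    also have "\<dots> = of_bool b * (\<integral>\<^sup>+X. G (labelled_config {q \<in> ?J. X q}) \<partial>coins ?J)"
      by (rule nn_integral_cmult[OF measurable_compose[OF labelled_config_measurable[OF J order_refl] G]])
    also have "(\<integral>\<^sup>+X. G (labelled_config {q \<in> ?J. X q}) \<partial>coins ?J) = (\<integral>\<^sup>+\<psi>. G \<psi> \<partial>labelled_thinning ?J)"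
      unfolding labelled_thinning_def
      by (rule nn_integral_distr[OF labelled_config_measurable[OF J order_refl], symmetric]) (use G in simp)
    finally show "(\<integral>\<^sup>+X. ?f (X(p := b)) \<partial>coins ?J) = of_bool b * (\<integral>\<^sup>+\<psi>. G \<psi> \<partial>labelled_thinning ?J)" .
  qed
  also have "\<dots> = ennreal (\<beta> (fst p)) * (\<integral>\<^sup>+\<psi>. G \<psi> \<partial>labelled_thinning ?J)"
    by (simp add: mult.commute)
  finally show ?thesis .
qed

text \<open>Local finiteness makes \<open>I\<close> countable, so the sum over labels and the
  expectation over coins can be exchanged; each label is then handled by
  \<open>nn_integral_coin_split\<close>.\<close>

lemma labelled_thinning_mecke:
  fixes I :: "('a \<times> nat) set"
  assumes I: "locally_finite I" and u: "u \<in> borel_measurable (borel \<Otimes>\<^sub>M config_space)"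
  shows "(\<integral>\<^sup>+\<psi>. \<integral>\<^sup>+x. u (x, remove_atom \<psi> x) \<partial>\<psi> \<partial>labelled_thinning I) =
    (\<integral>\<^sup>+p. ennreal (\<beta> (fst p)) * (\<integral>\<^sup>+\<psi>. u (fst p, \<psi>) \<partial>labelled_thinning (I - {p})) \<partial>count_space I)"
proof -
  let ?lab = "\<lambda>\<kappa>. labelled_config {p \<in> I. \<kappa> p}"
  let ?h = "\<lambda>p \<kappa>. of_bool (\<kappa> p) * u (fst p, labelled_config {q \<in> I - {p}. \<kappa> q})"
  have up: "(\<lambda>\<psi>. u (x, \<psi>)) \<in> borel_measurable config_space" for x
    using u by simp
  have "(\<integral>\<^sup>+\<psi>. \<integral>\<^sup>+x. u (x, remove_atom \<psi> x) \<partial>\<psi> \<partial>labelled_thinning I) =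
      (\<integral>\<^sup>+\<kappa>. \<integral>\<^sup>+x. u (x, remove_atom (?lab \<kappa>) x) \<partial>?lab \<kappa> \<partial>coins I)"
    unfolding labelled_thinning_def
    by (rule nn_integral_distr[OF labelled_config_measurable[OF I order_refl]])
      (simp add: nn_integral_remove_atom_measurable[OF u])
  also have "\<dots> = (\<integral>\<^sup>+\<kappa>. \<integral>\<^sup>+p. ?h p \<kappa> \<partial>count_space I \<partial>coins I)"
  proof (rule nn_integral_cong)
    fix \<kappa>
    let ?I = "{p \<in> I. \<kappa> p}"
    have lf: "locally_finite ?I" using I by (rule locally_finite_subset) auto
    have conf: "?lab \<kappa> \<in> space config_space"
      using labelled_config_in_configurations[OF lf] by (simp add: space_config_space)
    have m: "(\<lambda>x. u (x, remove_atom (?lab \<kappa>) x)) \<in> borel_measurable borel"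
      using conf by (intro measurable_compose[OF _ u] measurable_Pair remove_atom_measurable) auto
    have "(\<integral>\<^sup>+x. u (x, remove_atom (?lab \<kappa>) x) \<partial>?lab \<kappa>) =
        (\<integral>\<^sup>+p. u (fst p, remove_atom (?lab \<kappa>) (fst p)) \<partial>count_space ?I)"
      by (rule nn_integral_labelled_config[OF m])
    also have "\<dots> = (\<integral>\<^sup>+p. ?h p \<kappa> \<partial>count_space ?I)"
    proof (rule nn_integral_cong)
      fix p assume "p \<in> space (count_space ?I)"
      then have p: "p \<in> ?I" by simp
      have "emeasure (?lab \<kappa>) {fst p} = emeasure (labelled_config (?I - {p})) {fst p} + 1"
        using emeasure_labelled_config_insert[of p "?I - {p}" "{fst p}"] p by (simp add: insert_absorb)
      then have "emeasure (?lab \<kappa>) {fst p} \<noteq> 0" by simp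
      then have "remove_atom (?lab \<kappa>) (fst p) = labelled_config (?I - {p})"
        using remove_point_labelled_config[OF p] by (simp add: remove_atom_def)
      moreover have "?I - {p} = {q \<in> I - {p}. \<kappa> q}" by auto
      ultimately show "u (fst p, remove_atom (?lab \<kappa>) (fst p)) = ?h p \<kappa>" using p by simp
    qed
    \<comment> \<open>The condition of being kept moves from the index set into the factor
      \<open>of_bool (\<kappa> p)\<close>, so the range of summation no longer depends on the
      coins.\<close>
    also have "\<dots> = (\<integral>\<^sup>+p. ?h p \<kappa> \<partial>count_space I)"
      by (subst (1 2) nn_integral_count_space_indicator) (auto simp: indicator_def intro!: nn_integral_cong)
    finally show "(\<integral>\<^sup>+x. u (x, remove_atom (?lab \<kappa>) x) \<partial>?lab \<kappa>) = (\<integral>\<^sup>+p. ?h p \<kappa> \<partial>count_space I)" .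
  qed
  also have "\<dots> = (\<integral>\<^sup>+p. \<integral>\<^sup>+\<kappa>. ?h p \<kappa> \<partial>coins I \<partial>count_space I)"
    by (intro nn_integral_count_space_nn_integral locally_finite_countable I coin_times_measurable up)
  also have "\<dots> = (\<integral>\<^sup>+p. ennreal (\<beta> (fst p)) * (\<integral>\<^sup>+\<psi>. u (fst p, \<psi>) \<partial>labelled_thinning (I - {p})) \<partial>count_space I)"
    by (intro nn_integral_cong nn_integral_coin_split I up) auto
  finally show ?thesis .
qed

text \<open>The left side deletes the label \<open>(x, j)\<close>, the right side in effect the top
  label \<open>(x, n)\<close>. Renaming \<open>(x, n)\<close> to \<open>(x, j)\<close> keeps the
  base point and identifies the two laws.\<close>

lemma labelled_thinning_remove:
  fixes \<phi> :: "'a measure"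
  assumes \<phi>: "\<phi> \<in> configurations" and p: "p \<in> points \<phi>"
  shows "labelled_thinning (points \<phi> - {p}) = thinning_law \<beta> (remove_atom \<phi> (fst p))"
proof -
  obtain x j where [simp]: "p = (x, j)" by (cases p)
  obtain m :: nat where m: "emeasure \<phi> {x} = of_nat m"
    using configuration_nat[OF \<phi> singleton_relatively_compact] by blast
  have "j < m" using p by (simp add: points_def m)
  then obtain n where n: "m = Suc n" "j \<le> n" by (cases m) auto
  have x: "emeasure \<phi> {x} \<noteq> 0" using m n by (simp del: of_nat_Suc)
  have xn: "(x, n) \<in> points \<phi>"
    unfolding points_def by (simp only: m n mem_Collect_eq split of_nat_less_iff lessI)
  have pts: "points (remove_atom \<phi> x) = points \<phi> - {(x, n)}"
    using points_remove_point[OF \<phi> m[unfolded n]] x by (simp add: remove_atom_def)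
  have lf: "locally_finite (points \<phi> - {q})" for q
    using locally_finite_points[OF \<phi>] by (rule locally_finite_subset) auto
  let ?\<sigma> = "\<lambda>q. if q = (x, n) then (x, j) else q"
  have "labelled_thinning (points \<phi> - {(x, j)}) = labelled_thinning (points \<phi> - {(x, n)})"
  proof (rule labelled_thinning_reindex[OF lf lf])
    show "bij_betw ?\<sigma> (points \<phi> - {(x, j)}) (points \<phi> - {(x, n)})"
      using p xn by (intro bij_betwI[where g="\<lambda>q. if q = (x, j) then (x, n) else q"]) auto
  qed auto
  then show ?thesis by (simp add: thinning_law_eq pts)
qed

end

section \<open>Measurability of the thinning kernel\<close>

text \<open>The integrand \<open>exp (- \<integral> f d\<psi>)\<close> of the Laplace functional,
  for the simple function \<open>f = \<Sum> t 1_B\<close>.\<close>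

definition exp_count :: "('a::topological_space set \<times> real) list \<Rightarrow> 'a measure \<Rightarrow> real" where
  "exp_count Bs \<psi> = exp (- (\<Sum>(B, t)\<leftarrow>Bs. t * measure \<psi> B))"

text \<open>The indicator of a joint counting event, as a product over a list so that an induction
  can peel off one count at a time.\<close>

definition count_event :: "('a::topological_space set \<times> nat) list \<Rightarrow> 'a measure \<Rightarrow> real" where
  "count_event As \<psi> = (\<Prod>(A, k)\<leftarrow>As. of_bool (measure \<psi> A = real k))"

definition good_weights :: "('a::topological_space set \<times> real) list \<Rightarrow> bool" where
  "good_weights Bs \<longleftrightarrow> (\<forall>(B, t)\<in>set Bs. B \<in> relatively_compact_borel \<and> 0 \<le> t)"

lemma weight_measurable:
  assumes "good_weights Bs"
  shows "(\<lambda>x. \<Sum>(B, t)\<leftarrow>Bs. t * indicator B x :: real) \<in> borel_measurable borel"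
  using assms
proof (induction Bs)
  case (Cons b Bs)
  obtain B t where [simp]: "b = (B, t)" by (cases b)
  have [measurable]: "B \<in> sets borel"
    using Cons(2) by (auto simp: good_weights_def relatively_compact_borel_def)
  have [measurable]: "(\<lambda>x. \<Sum>(B, t)\<leftarrow>Bs. t * indicator B x :: real) \<in> borel_measurable borel"
    using Cons by (simp add: good_weights_def)
  show ?case by simp
qed simp

lemma measure_config_nat:
  assumes "\<psi> \<in> configurations" "A \<in> relatively_compact_borel"
  obtains n :: nat where "measure \<psi> A = real n" "emeasure \<psi> A = of_nat n"
  using configuration_nat[OF assms] by (auto simp: measure_def)

lemma count_event_bounds: "0 \<le> count_event As \<psi>" "count_event As \<psi> \<le> 1"
  by (induction As) (auto simp: count_event_def of_bool_def)

lemma exp_count_bounds: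
  assumes "good_weights Bs" shows "0 \<le> exp_count Bs \<psi>" "exp_count Bs \<psi> \<le> 1"
proof -
  have "0 \<le> (\<Sum>(B, t)\<leftarrow>Bs. t * measure \<psi> B)"
    using assms by (intro sum_list_nonneg) (auto simp: good_weights_def)
  then show "exp_count Bs \<psi> \<le> 1" by (simp add: exp_count_def)
qed (simp add: exp_count_def)

lemma count_event_measurable:
  assumes "fst ` set As \<subseteq> relatively_compact_borel"
  shows "count_event As \<in> borel_measurable config_space"
  using assms
proof (induction As)
  case (Cons a As)
  obtain A k where [simp]: "a = (A, k)" by (cases a)
  have [measurable]: "(\<lambda>\<psi>. measure \<psi> A) \<in> borel_measurable config_space"
    unfolding measure_def using Cons(2) by (intro borel_measurable_enn2real measurable_emeasure_config) simp
  have [measurable]: "count_event As \<in> borel_measurable config_space"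
    using Cons by simp
  have "count_event (a # As) = (\<lambda>\<psi>. of_bool (measure \<psi> A = real k) * count_event As \<psi>)"
    by (auto simp: count_event_def)
  then show ?case by simp
qed (simp add: count_event_def[abs_def])

lemma exp_count_measurable:
  assumes "good_weights Bs"
  shows "exp_count Bs \<in> borel_measurable config_space"
  using assms
proof (induction Bs)
  case (Cons b Bs)
  obtain B t where [simp]: "b = (B, t)" by (cases b)
  have [measurable]: "(\<lambda>\<psi>. measure \<psi> B) \<in> borel_measurable config_space"
    unfolding measure_def using Cons(2)
    by (intro borel_measurable_enn2real measurable_emeasure_config) (simp add: good_weights_def)
  have [measurable]: "exp_count Bs \<in> borel_measurable config_space"
    using Cons by (simp add: good_weights_def)
  have "exp_count (b # Bs) = (\<lambda>\<psi>. exp (- t * measure \<psi> B) * exp_count Bs \<psi>)"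
    by (auto simp: exp_count_def exp_add[symmetric])
  then show ?case by simp
qed (simp add: exp_count_def[abs_def])

section \<open>Laplace functional of the thinning and probabilities of counting events\<close>

context thinning
begin

lemma prob_space_thinning_law:
  "\<phi> \<in> configurations \<Longrightarrow> prob_space (thinning_law \<beta> \<phi>)"
  by (simp add: thinning_law_eq prob_space_labelled_thinning locally_finite_points)

lemma sets_thinning_law[simp, measurable_cong]: "sets (thinning_law \<beta> \<phi>) = sets config_space"
  by (simp add: thinning_law_eq)

text \<open>A label at \<open>x\<close> contributes the factor \<open>exp (- f x)\<close> if it is
  kept and 1 otherwise, with mean \<open>1 - \<beta> x + \<beta> x * exp (- f x)\<close>.
  Independence multiplies these means, and minus the logarithm of the product is an integral against
  \<open>\<phi>\<close>. That integral is a finite sum, so \<open>enn2real\<close> loses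
  nothing.\<close>

lemma integral_exp_count:
  assumes \<phi>: "\<phi> \<in> configurations" and Bs: "good_weights Bs"
  defines "f \<equiv> \<lambda>x. \<Sum>(B, t)\<leftarrow>Bs. t * indicator B x"
  shows "(\<integral>\<psi>. exp_count Bs \<psi> \<partial>thinning_law \<beta> \<phi>) =
    exp (- enn2real (\<integral>\<^sup>+x. ennreal (- ln (1 - \<beta> x + \<beta> x * exp (- f x))) \<partial>\<phi>))"
proof -
  let ?I = "points \<phi>"
  define C where "C = (\<Union>(B, t)\<in>set Bs. B)"
  \<comment> \<open>\<open>f\<close> vanishes outside the finite union \<open>C\<close> of
    relatively compact sets, so only the finitely many labels in \<open>J\<close> matter.\<close>
  define J where "J = {p \<in> ?I. fst p \<in> C}"
  define h where "h x = - ln (1 - \<beta> x + \<beta> x * exp (- f x))" for x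
  have lf: "locally_finite ?I" by (rule locally_finite_points[OF \<phi>])
  have rc: "B \<in> relatively_compact_borel" "0 \<le> t" if "(B, t) \<in> set Bs" for B t
    using Bs that by (auto simp: good_weights_def)
  have f_nonneg: "0 \<le> f x" for x
    unfolding f_def using rc by (intro sum_list_nonneg) (auto simp: indicator_def)
  have f_zero: "f x = 0" if "x \<notin> C" for x
  proof -
    have "f x = (\<Sum>b\<leftarrow>Bs. 0)"
      unfolding f_def using that by (intro arg_cong[where f=sum_list] map_cong) (auto simp: C_def indicator_def)
    then show ?thesis by simp
  qed
  have "J = (\<Union>(B, t)\<in>set Bs. {p \<in> ?I. fst p \<in> B})" by (auto simp: J_def C_def)
  then have J: "finite J" "J \<subseteq> ?I"
    using lf rc by (auto simp: locally_finite_def J_def)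
  have arg_pos: "0 < 1 - \<beta> x + \<beta> x * exp (- f x)" and arg_le: "1 - \<beta> x + \<beta> x * exp (- f x) \<le> 1" for x
  proof -
    have "\<beta> x * exp (- f x) \<le> \<beta> x * 1"
      by (rule mult_left_mono) (auto simp: f_nonneg)
    then show "1 - \<beta> x + \<beta> x * exp (- f x) \<le> 1" by simp
    \<comment> \<open>Positivity, needed for the logarithm, also holds when
      \<open>\<beta> x = 1\<close>: the exponential is then the only term left.\<close>
    show "0 < 1 - \<beta> x + \<beta> x * exp (- f x)"
    proof (cases "\<beta> x = 1")
      case False
      then have "\<beta> x < 1" using \<beta>_le_1[of x] by linarith
      then show ?thesis by (intro add_pos_nonneg) auto
    qed simp
  qed
  have h_nonneg: "0 \<le> h x" for x
    unfolding h_def using arg_pos[of x] arg_le[of x] by simp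
  have h_zero: "h x = 0" if "x \<notin> C" for x
    unfolding h_def f_zero[OF that] by simp
  have count: "exp_count Bs (labelled_config {p \<in> ?I. \<kappa> p}) = (\<Prod>p\<in>J. exp (- of_bool (\<kappa> p) * f (fst p)))" for \<kappa>
  proof -
    have "(\<Sum>(B, t)\<leftarrow>Bs. t * measure (labelled_config {p \<in> ?I. \<kappa> p}) B) =
        (\<Sum>(B, t)\<leftarrow>Bs. \<Sum>p\<in>J. of_bool (\<kappa> p) * (t * indicator B (fst p)))"
    proof (intro arg_cong[where f=sum_list] map_cong refl, clarify)
      fix B t assume B: "(B, t) \<in> set Bs"
      have fin: "finite {p \<in> ?I. fst p \<in> B}" using lf rc(1)[OF B] by (simp add: locally_finite_def)
      have "emeasure (labelled_config {p \<in> ?I. \<kappa> p}) B = ennreal (\<Sum>p\<in>{p \<in> ?I. fst p \<in> B}. of_bool (\<kappa> p))"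
        unfolding emeasure_kept[OF lf rc(1)[OF B]]
        by (rule trans[OF sum.cong[OF refl] sum_ennreal]) (auto simp: of_bool_def)
      then have "measure (labelled_config {p \<in> ?I. \<kappa> p}) B = (\<Sum>p\<in>{p \<in> ?I. fst p \<in> B}. of_bool (\<kappa> p))"
        unfolding measure_def by (simp add: sum_nonneg)
      also have "\<dots> = (\<Sum>p\<in>J. of_bool (\<kappa> p) * indicator B (fst p))"
        using J B by (intro sum.mono_neutral_cong_left) (auto simp: J_def C_def indicator_def)
      finally show "t * measure (labelled_config {p \<in> ?I. \<kappa> p}) B =
          (\<Sum>p\<in>J. of_bool (\<kappa> p) * (t * indicator B (fst p)))"
        by (simp add: sum_distrib_left mult.left_commute)
    qed
    also have "\<dots> = (\<Sum>p\<in>J. of_bool (\<kappa> p) * f (fst p))"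
      unfolding f_def
      by (induction Bs) (auto simp: sum.distrib distrib_left)
    finally show ?thesis
      by (simp add: exp_count_def exp_sum[OF J(1), symmetric] sum_negf)
  qed
  let ?B = "\<lambda>p. measure_pmf (bernoulli_pmf (\<beta> (fst p)))"
  interpret product_prob_space ?B ?I
    by unfold_locales
  interpret fin: finite_product_prob_space ?B J
    by unfold_locales (fact J)
  let ?g = "\<lambda>\<kappa>. \<Prod>p\<in>J. exp (- of_bool (\<kappa> p) * f (fst p))"
  have "(\<integral>\<psi>. exp_count Bs \<psi> \<partial>thinning_law \<beta> \<phi>) = (\<integral>\<kappa>. ?g \<kappa> \<partial>coins ?I)"
    unfolding thinning_law_eq labelled_thinning_def count[symmetric]
    by (intro integral_distr labelled_config_measurable lf order_refl exp_count_measurable Bs)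
  \<comment> \<open>The integrand reads only the coins in \<open>J\<close>, so the product over all
    labels may be replaced by its finite marginal, where the integral of a product
    factorises.\<close>
  also have "\<dots> = (\<integral>\<kappa>. ?g (restrict \<kappa> J) \<partial>coins ?I)"
    by (intro Bochner_Integration.integral_cong prod.cong) auto
  also have "\<dots> = (\<integral>\<kappa>. ?g \<kappa> \<partial>distr (coins ?I) (coins J) (\<lambda>\<kappa>. restrict \<kappa> J))"
    by (intro integral_distr[symmetric] measurable_restrict_subset J borel_measurable_prod coin_borel_measurable)
  also have "\<dots> = (\<integral>\<kappa>. ?g \<kappa> \<partial>coins J)"
    by (simp only: distr_PiM_restrict_finite[OF J])
  also have "\<dots> = (\<Prod>p\<in>J. \<integral>b. exp (- of_bool b * f (fst p)) \<partial>?B p)"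
    by (rule product_integral_prod[OF J(1)]) (auto intro!: integrable_measure_pmf_finite)
  also have "\<dots> = (\<Prod>p\<in>J. exp (- h (fst p)))"
    unfolding h_def using arg_pos by (intro prod.cong) (auto simp: algebra_simps)
  also have "\<dots> = exp (- (\<Sum>p\<in>J. h (fst p)))"
    by (simp add: exp_sum[OF J(1), symmetric] sum_negf)
  also have "(\<Sum>p\<in>J. h (fst p)) = enn2real (\<integral>\<^sup>+x. ennreal (h x) \<partial>\<phi>)"
  proof -
    have [measurable]: "h \<in> borel_measurable borel"
    proof -
      have "(\<lambda>x. \<Sum>(B, t)\<leftarrow>Bs. t * indicator B x :: real) \<in> borel_measurable borel"
        by (rule weight_measurable[OF Bs])
      then have [measurable]: "f \<in> borel_measurable borel" by (simp add: f_def)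
      show ?thesis unfolding h_def by measurable
    qed
    have "(\<integral>\<^sup>+x. ennreal (h x) \<partial>\<phi>) = (\<integral>\<^sup>+p. ennreal (h (fst p)) \<partial>count_space ?I)"
      by (subst labelled_config_points[OF \<phi>, symmetric]) (rule nn_integral_labelled_config, measurable)
    also have "\<dots> = (\<Sum>p\<in>J. ennreal (h (fst p)))"
      using J by (intro nn_integral_count_space') (auto simp: J_def h_zero)
    also have "\<dots> = ennreal (\<Sum>p\<in>J. h (fst p))" by (simp add: h_nonneg)
    finally show ?thesis by (simp add: sum_nonneg h_nonneg)
  qed
  finally show ?thesis unfolding h_def .
qed

text \<open>In the closed form \<open>\<phi>\<close> enters only through the integral of a fixed
  function, which is measurable in \<open>\<phi>\<close>.\<close>

lemma integral_exp_count_measurable: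
  assumes Bs: "good_weights Bs"
  shows "(\<lambda>\<phi>. \<integral>\<psi>. exp_count Bs \<psi> \<partial>thinning_law \<beta> \<phi>) \<in> borel_measurable config_space"
proof -
  have "(\<lambda>x. \<Sum>(B, t)\<leftarrow>Bs. t * indicator B x :: real) \<in> borel_measurable borel"
    by (rule weight_measurable[OF Bs])
  note [measurable] = this
  have "(\<lambda>\<phi>. exp (- enn2real (\<integral>\<^sup>+x. ennreal (- ln (1 - \<beta> x + \<beta> x * exp (- (\<Sum>(B, t)\<leftarrow>Bs. t * indicator B x)))) \<partial>\<phi>)))
      \<in> borel_measurable config_space"
    by (intro borel_measurable_exp[THEN measurable_compose[rotated]] borel_measurable_uminus borel_measurable_enn2real
        nn_integral_config_measurable') measurable
  then show ?thesis
    using integral_exp_count[OF _ Bs]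
    by (intro measurable_cong[THEN iffD2, OF integral_exp_count[OF _ Bs]]) (simp_all add: space_config_space)
qed

text \<open>The event \<open>N = k\<close> is recovered from the weights \<open>n\<^sup>-\<^sup>N = exp (- N ln n)\<close> as the limit of
  \<open>n\<^sup>k (n\<^sup>-\<^sup>N - \<Sum>j<k. n\<^sup>-\<^sup>j 1{N = j})\<close>.\<close>

lemma integral_count_event_measurable:
  assumes "fst ` set As \<subseteq> relatively_compact_borel" "good_weights Bs"
  shows "(\<lambda>\<phi>. \<integral>\<psi>. count_event As \<psi> * exp_count Bs \<psi> \<partial>thinning_law \<beta> \<phi>) \<in> borel_measurable config_space"
  using assms
\<comment> \<open>\<open>Bs\<close> must vary: each count removed from \<open>As\<close> is traded
  for one more exponential weight in \<open>Bs\<close>.\<close>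
proof (induction As arbitrary: Bs)
  case Nil
  then show ?case using integral_exp_count_measurable by (simp add: count_event_def)
next
  case (Cons a As)
  obtain A k where a: "a = (A, k)" by (cases a)
  have A: "A \<in> relatively_compact_borel" and As: "fst ` set As \<subseteq> relatively_compact_borel"
    using Cons(2) by (auto simp: a)
  define W where "W \<psi> = count_event As \<psi> * exp_count Bs \<psi>" for \<psi>
  have W_bounds: "0 \<le> W \<psi>" "W \<psi> \<le> 1" for \<psi>
    unfolding W_def using count_event_bounds[of As \<psi>] exp_count_bounds[OF Cons(3), of \<psi>]
    by (auto intro: mult_le_one)
  have W_measurable[measurable]: "W \<in> borel_measurable config_space"
    unfolding W_def using count_event_measurable[OF As] exp_count_measurable[OF Cons(3)] by simp
  have [measurable]: "(\<lambda>\<psi>. measure \<psi> A) \<in> borel_measurable config_space"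
    unfolding measure_def using A by (intro borel_measurable_enn2real measurable_emeasure_config)
  define V where "V j \<psi> = of_bool (measure \<psi> A = real j) * W \<psi>" for j \<psi>
  have V_measurable[measurable]: "V j \<in> borel_measurable config_space" for j
    unfolding V_def by measurable
  have V_bounds: "0 \<le> V j \<psi>" "V j \<psi> \<le> 1" for j \<psi>
    unfolding V_def using W_bounds[of \<psi>] by auto
  have V: "count_event ((A, j) # As) \<psi> * exp_count Bs \<psi> = V j \<psi>" for j \<psi>
    by (simp add: V_def W_def count_event_def)
  \<comment> \<open>\<open>Suc n\<close> keeps the weight \<open>ln (n + 1)\<close> nonnegative,
    also for \<open>n = 0\<close>; on \<open>{N = j}\<close> with \<open>N = \<psi> A\<close>,
    \<open>E n\<close> is \<open>W\<close> times the \<open>j\<close>-th power of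
    \<open>1 / (n + 1)\<close>.\<close>
  define E where "E n \<psi> = count_event As \<psi> * exp_count ((A, ln (real (Suc n))) # Bs) \<psi>" for n \<psi>
  have good: "good_weights ((A, ln (real (Suc n))) # Bs)" for n
    using A Cons(3) by (auto simp: good_weights_def)
  have E_measurable[measurable]: "E n \<in> borel_measurable config_space" for n
    unfolding E_def using count_event_measurable[OF As] exp_count_measurable[OF good] by simp
  have E_bounds: "0 \<le> E n \<psi>" "E n \<psi> \<le> 1" for n \<psi>
    unfolding E_def using count_event_bounds[of As \<psi>] exp_count_bounds[OF good, of n \<psi>]
    by (auto intro: mult_le_one)
  have E_eq: "E n \<psi> = W \<psi> * (1 / real (Suc n)) ^ N" if "measure \<psi> A = real N" for n \<psi> N
  proof -
    have "exp (- (ln (real (Suc n)) * real N)) = (1 / real (Suc n)) ^ N"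
      by (simp add: exp_minus exp_of_nat2_mult power_one_over inverse_eq_divide del: of_nat_Suc)
    then show ?thesis
      by (simp add: E_def W_def exp_count_def that exp_diff exp_minus field_simps del: of_nat_Suc)
  qed
  have "(\<lambda>\<phi>. \<integral>\<psi>. V k \<psi> \<partial>thinning_law \<beta> \<phi>) \<in> borel_measurable config_space"
  \<comment> \<open>Strong induction: to isolate \<open>N = k\<close>, the contributions of all
    \<open>j < k\<close> are subtracted, and their integrals must already be known to be
    measurable.\<close>
  proof (induction k rule: less_induct)
    case (less k)
    define Q where "Q n \<psi> = real (Suc n) ^ k * (E n \<psi> - (\<Sum>j<k. (1 / real (Suc n)) ^ j * V j \<psi>))" for n \<psi>
    have Q_measurable[measurable]: "Q n \<in> borel_measurable config_space" for n
      unfolding Q_def by measurable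
    \<comment> \<open>Smaller counts cancel exactly, the count \<open>k\<close> keeps
      \<open>W\<close>, and larger counts carry a positive power of \<open>1 / (n + 1)\<close>. This
      yields both the limit and the bound 1 for dominated convergence.\<close>
    have Q_eq: "Q n \<psi> = (if N < k then 0 else (1 / real (Suc n)) ^ (N - k) * W \<psi>)"
      if N: "measure \<psi> A = real N" for n \<psi> N
    proof -
      have "(\<Sum>j<k. (1 / real (Suc n)) ^ j * V j \<psi>) = (\<Sum>j<k. if j = N then (1 / real (Suc n)) ^ N * W \<psi> else 0)"
        by (intro sum.cong) (auto simp: V_def N)
      also have "\<dots> = (if N < k then (1 / real (Suc n)) ^ N * W \<psi> else 0)" by simp
      finally have sum: "(\<Sum>j<k. (1 / real (Suc n)) ^ j * V j \<psi>) = (if N < k then (1 / real (Suc n)) ^ N * W \<psi> else 0)" .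
      have pow: "real (Suc n) ^ k * (1 / real (Suc n)) ^ N = (1 / real (Suc n)) ^ (N - k)" if "k \<le> N"
        using that by (simp add: power_one_over power_diff field_simps del: of_nat_Suc)
      show ?thesis
        unfolding Q_def sum E_eq[OF N] using pow by (auto simp del: of_nat_Suc)
    qed
    have Q_bound: "norm (Q n \<psi>) \<le> 1" if N: "measure \<psi> A = real N" for n \<psi> N
      unfolding Q_eq[OF N] using W_bounds[of \<psi>] by (auto simp: abs_mult intro!: mult_le_one power_le_one)
    have Q_lim: "(\<lambda>n. Q n \<psi>) \<longlonglongrightarrow> V k \<psi>" if N: "measure \<psi> A = real N" for \<psi> N
    proof (cases N k rule: linorder_cases)
      case greater
      have "(\<lambda>n. (1 / real (Suc n)) ^ (N - k)) \<longlonglongrightarrow> 0 ^ (N - k)"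
        by (intro tendsto_power LIMSEQ_inverse_real_of_nat[unfolded inverse_eq_divide])
      then have "(\<lambda>n. (1 / real (Suc n)) ^ (N - k) * W \<psi>) \<longlonglongrightarrow> 0 * W \<psi>"
        using greater by (intro tendsto_mult tendsto_const) (simp add: zero_power)
      with greater show ?thesis by (simp add: Q_eq[OF N] V_def N del: of_nat_Suc)
    qed (simp_all add: Q_eq[OF N] V_def N)
    show ?case
    proof (rule borel_measurable_LIMSEQ_real)
      fix \<phi> :: "'a measure" assume "\<phi> \<in> space config_space"
      then have \<phi>: "\<phi> \<in> configurations" by (simp add: space_config_space)
      interpret T: prob_space "thinning_law \<beta> \<phi>" by (rule prob_space_thinning_law[OF \<phi>])
      have nat: "AE \<psi> in thinning_law \<beta> \<phi>. \<exists>N::nat. measure \<psi> A = real N"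
        using measure_config_nat[OF _ A]
        by (intro AE_I2) (metis sets_eq_imp_space_eq[OF sets_thinning_law] space_config_space)
      have int: "integrable (thinning_law \<beta> \<phi>) (V j)" "integrable (thinning_law \<beta> \<phi>) (E n)" for j n
        using V_bounds E_bounds by (auto intro!: T.integrable_const_bound[where B=1])
      have "(\<lambda>n. \<integral>\<psi>. Q n \<psi> \<partial>thinning_law \<beta> \<phi>) \<longlonglongrightarrow> (\<integral>\<psi>. V k \<psi> \<partial>thinning_law \<beta> \<phi>)"
      proof (rule integral_dominated_convergence[where w="\<lambda>_. 1"])
        show "AE \<psi> in thinning_law \<beta> \<phi>. (\<lambda>n. Q n \<psi>) \<longlonglongrightarrow> V k \<psi>"
          using nat by eventually_elim (auto intro: Q_lim)
        show "AE \<psi> in thinning_law \<beta> \<phi>. norm (Q n \<psi>) \<le> 1" for n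
          using nat by eventually_elim (use Q_bound in auto)
      qed auto
      moreover have "(\<integral>\<psi>. Q n \<psi> \<partial>thinning_law \<beta> \<phi>) = real (Suc n) ^ k * ((\<integral>\<psi>. E n \<psi> \<partial>thinning_law \<beta> \<phi>) -
          (\<Sum>j<k. (1 / real (Suc n)) ^ j * (\<integral>\<psi>. V j \<psi> \<partial>thinning_law \<beta> \<phi>)))" for n
        unfolding Q_def using int
        by (simp add: Bochner_Integration.integral_diff Bochner_Integration.integral_sum del: of_nat_Suc)
      ultimately show "(\<lambda>n. real (Suc n) ^ k * ((\<integral>\<psi>. E n \<psi> \<partial>thinning_law \<beta> \<phi>) -
          (\<Sum>j<k. (1 / real (Suc n)) ^ j * (\<integral>\<psi>. V j \<psi> \<partial>thinning_law \<beta> \<phi>)))) \<longlonglongrightarrow> (\<integral>\<psi>. V k \<psi> \<partial>thinning_law \<beta> \<phi>)"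
        by simp
    next
      show "(\<lambda>\<phi>. real (Suc n) ^ k * ((\<integral>\<psi>. E n \<psi> \<partial>thinning_law \<beta> \<phi>) -
          (\<Sum>j<k. (1 / real (Suc n)) ^ j * (\<integral>\<psi>. V j \<psi> \<partial>thinning_law \<beta> \<phi>)))) \<in> borel_measurable config_space" for n
        using less.IH Cons.IH[OF As good] unfolding E_def
        by (intro borel_measurable_times borel_measurable_diff borel_measurable_sum borel_measurable_const) auto
    qed
  qed
  then show ?case by (simp add: a V)
qed

end

section \<open>Counting events as a generating pi-system\<close>

definition count_sets :: "'a::topological_space measure set set" where
  "count_sets = {{\<psi> \<in> configurations. \<forall>(A, k)\<in>set As. emeasure \<psi> A = of_nat k} | As :: ('a set \<times> nat) list.
     fst ` set As \<subseteq> relatively_compact_borel}"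

lemma count_sets_in_sets: "count_sets \<subseteq> sets config_space"
proof
  fix S :: "'a::topological_space measure set" assume "S \<in> count_sets"
  then obtain As :: "('a set \<times> nat) list"
    where S: "S = {\<psi> \<in> configurations. \<forall>(A, k)\<in>set As. emeasure \<psi> A = of_nat k}"
      and As: "fst ` set As \<subseteq> relatively_compact_borel"
    by (auto simp: count_sets_def)
  have "S = {\<psi> \<in> space config_space. \<forall>z\<in>set As. emeasure \<psi> (fst z) = of_nat (snd z)}"
    by (auto simp: S space_config_space)
  also have "\<dots> \<in> sets config_space"
  proof (rule sets.sets_Collect_finite_All)
    fix z assume "z \<in> set As"
    then have "(\<lambda>\<psi>. emeasure \<psi> (fst z)) \<in> borel_measurable config_space"
      using As by (intro measurable_emeasure_config) auto
    then show "{\<psi> \<in> space config_space. emeasure \<psi> (fst z) = of_nat (snd z)} \<in> sets config_space"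
      by (rule borel_measurable_eq) simp
  qed simp
  finally show "S \<in> sets config_space" .
qed

lemma Int_stable_count_sets: "Int_stable count_sets"
proof (rule Int_stableI)
  fix S S' :: "'a::topological_space measure set" assume "S \<in> count_sets" "S' \<in> count_sets"
  then obtain As As' :: "('a set \<times> nat) list"
    where "S = {\<psi> \<in> configurations. \<forall>(A, k)\<in>set As. emeasure \<psi> A = of_nat k}" "fst ` set As \<subseteq> relatively_compact_borel"
      "S' = {\<psi> \<in> configurations. \<forall>(A, k)\<in>set As'. emeasure \<psi> A = of_nat k}" "fst ` set As' \<subseteq> relatively_compact_borel"
    by (auto simp: count_sets_def)
  then have "S \<inter> S' = {\<psi> \<in> configurations. \<forall>(A, k)\<in>set (As @ As'). emeasure \<psi> A = of_nat k}"
    "fst ` set (As @ As') \<subseteq> relatively_compact_borel" by auto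
  then show "S \<inter> S' \<in> count_sets" unfolding count_sets_def by blast
qed

text \<open>On a relatively compact set a configuration takes only natural values, so the preimage
  of a Borel set under \<open>\<psi> \<mapsto> \<psi> A\<close> is a countable union of events
  \<open>\<psi> A = k\<close>.\<close>

lemma sets_config_space_eq:
  "sets config_space = sigma_sets configurations (count_sets :: 'a::topological_space measure set set)"
proof
  have sub: "count_sets \<subseteq> Pow (configurations :: 'a measure set)" by (auto simp: count_sets_def)
  show "sigma_sets configurations count_sets \<subseteq> sets (config_space :: 'a measure measure)"
    using count_sets_in_sets by (intro sets.sigma_sets_subset') (auto simp flip: space_config_space)
  let ?S = "sigma configurations (count_sets :: 'a measure set set)"
  have "(\<lambda>\<psi>. \<psi>) \<in> ?S \<rightarrow>\<^sub>M (config_space :: 'a measure measure)"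
  proof (rule measurable_config_spaceI)
    fix A :: "'a set" assume A: "A \<in> relatively_compact_borel"
    show "(\<lambda>\<psi>. emeasure \<psi> A) \<in> borel_measurable ?S"
    proof (rule measurableI)
      fix B :: "ennreal set" assume "B \<in> sets borel"
      have "(\<lambda>\<psi>. emeasure \<psi> A) -` B \<inter> space ?S =
          (\<Union>k\<in>{k::nat. of_nat k \<in> B}. {\<psi> \<in> configurations. \<forall>(A, k)\<in>set [(A, k)]. emeasure \<psi> A = of_nat k})"
        using configuration_nat[OF _ A] sub by (fastforce simp: space_measure_of)
      also have "\<dots> \<in> sets ?S"
      proof (intro sets.countable_UN')
        have "{\<psi> \<in> configurations. \<forall>(A, k)\<in>set [(A, k)]. emeasure \<psi> A = of_nat k} \<in> count_sets" for k
          unfolding count_sets_def using A by (intro CollectI exI[of _ "[(A, k)]"]) auto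
        then show "(\<lambda>k. {\<psi> \<in> configurations. \<forall>(A, k)\<in>set [(A, k)]. emeasure \<psi> A = of_nat k}) ` {k::nat. of_nat k \<in> B} \<subseteq> sets ?S"
          using sub by auto
      qed simp
      finally show "(\<lambda>\<psi>. emeasure \<psi> A) -` B \<inter> space ?S \<in> sets ?S" .
    qed simp
  qed (use sub in simp)
  then have "S \<in> sets ?S" if "S \<in> sets config_space" for S
    using measurable_sets[OF _ that, of "\<lambda>\<psi>. \<psi>" ?S] sets.sets_into_space[OF that] sub
    by (simp add: space_config_space Int_absorb2)
  then show "sets config_space \<subseteq> sigma_sets configurations (count_sets :: 'a measure set set)"
    using sub by auto
qed

context thinning
begin

text \<open>On the generating pi-system \<open>count_sets\<close> the probabilities are
  \<open>integral_count_event_measurable\<close> with the empty list of weights, for which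
  \<open>exp_count\<close> is 1. The total mass is constant.\<close>

lemma thinning_law_measurable: "thinning_law \<beta> \<in> config_space \<rightarrow>\<^sub>M prob_algebra config_space"
proof (rule measurable_prob_algebraI)
  show "thinning_law \<beta> \<in> config_space \<rightarrow>\<^sub>M subprob_algebra config_space"
  proof (rule measurable_subprob_algebra_generated[OF sets_config_space_eq Int_stable_count_sets])
    fix S :: "'a measure set" assume S: "S \<in> count_sets"
    then obtain As :: "('a set \<times> nat) list"
      where S_eq: "S = {\<psi> \<in> configurations. \<forall>(A, k)\<in>set As. emeasure \<psi> A = of_nat k}"
        and As: "fst ` set As \<subseteq> relatively_compact_borel"
      by (auto simp: count_sets_def)
    have ind: "count_event As \<psi> = indicator S \<psi>" if \<psi>: "\<psi> \<in> configurations" for \<psi>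
    proof -
      have "measure \<psi> A = real k \<longleftrightarrow> emeasure \<psi> A = of_nat k" if "(A, k) \<in> set As" for A k
        using measure_config_nat[OF \<psi>, of A] As that by (metis fst_conv image_subset_iff of_nat_eq_iff)
      then have "count_event As \<psi> = of_bool (\<forall>(A, k)\<in>set As. emeasure \<psi> A = of_nat k)"
        unfolding count_event_def by (induction As) auto
      then show ?thesis using \<psi> by (simp add: S_eq indicator_def)
    qed
    have "emeasure (thinning_law \<beta> \<phi>) S = ennreal (\<integral>\<psi>. count_event As \<psi> * exp_count [] \<psi> \<partial>thinning_law \<beta> \<phi>)"
      if \<phi>: "\<phi> \<in> space config_space" for \<phi>
    proof -
      interpret T: prob_space "thinning_law \<beta> \<phi>"
        using \<phi> by (intro prob_space_thinning_law) (simp add: space_config_space)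
      have "(\<integral>\<psi>. count_event As \<psi> * exp_count [] \<psi> \<partial>thinning_law \<beta> \<phi>) = (\<integral>\<psi>. indicator S \<psi> \<partial>thinning_law \<beta> \<phi>)"
        using sets_eq_imp_space_eq[OF sets_thinning_law[of \<phi>]]
        by (intro Bochner_Integration.integral_cong) (auto simp: ind exp_count_def space_config_space)
      also have "\<dots> = measure (thinning_law \<beta> \<phi>) S"
      proof -
        have "S \<in> sets config_space" using S count_sets_in_sets by (rule rev_subsetD)
        then have "S \<inter> space (thinning_law \<beta> \<phi>) = S"
          using sets.Int_space_eq2[of S "thinning_law \<beta> \<phi>"] by simp
        then show ?thesis by simp
      qed
      finally show ?thesis by (simp add: T.emeasure_eq_measure)
    qed
    note eq = this
    show "(\<lambda>\<phi>. emeasure (thinning_law \<beta> \<phi>) S) \<in> borel_measurable config_space"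
      using integral_count_event_measurable[OF As, of "[]"]
      by (intro measurable_cong[THEN iffD2, OF eq]) (auto simp: good_weights_def)
  next
    show "(\<lambda>\<phi>. emeasure (thinning_law \<beta> \<phi>) configurations) \<in> borel_measurable config_space"
    proof (rule measurable_cong[THEN iffD2])
      fix \<phi> :: "'a measure" assume "\<phi> \<in> space config_space"
      then interpret T: prob_space "thinning_law \<beta> \<phi>"
        by (intro prob_space_thinning_law) (simp add: space_config_space)
      show "emeasure (thinning_law \<beta> \<phi>) configurations = 1"
        using T.emeasure_space_1 sets_eq_imp_space_eq[OF sets_thinning_law[of \<phi>]]
        by (simp add: space_config_space)
    qed simp
  qed (auto simp: count_sets_def prob_space_thinning_law space_config_space intro: prob_space_imp_subprob_space)
qed (simp add: prob_space_thinning_law space_config_space)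

end

section \<open>The Papangelou intensity of a thinning\<close>

context thinning
begin

lemma thinning_law_measurable_subprob[measurable]:
  "thinning_law \<beta> \<in> config_space \<rightarrow>\<^sub>M subprob_algebra config_space"
  by (rule measurable_prob_algebraD[OF thinning_law_measurable])

lemma nn_integral_thinning_law_measurable:
  assumes [measurable]: "u \<in> borel_measurable (borel \<Otimes>\<^sub>M config_space)"
  shows "(\<lambda>(x, \<phi>). ennreal (\<beta> x) * (\<integral>\<^sup>+\<psi>. u (x, \<psi>) \<partial>thinning_law \<beta> \<phi>))
    \<in> borel_measurable (borel \<Otimes>\<^sub>M config_space)"
proof -
  have [measurable]: "(\<lambda>z. \<integral>\<^sup>+\<psi>. u (fst z, \<psi>) \<partial>thinning_law \<beta> (snd z)) \<in> borel_measurable (borel \<Otimes>\<^sub>M config_space)"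
    by (rule nn_integral_measurable_subprob_algebra2[where N=config_space]) measurable
  show ?thesis unfolding split_beta' by measurable
qed

text \<open>Replacing a deleted label by \<open>remove_atom\<close> makes the summand depend on the
  base point only, so the sum over labels becomes an integral against \<open>\<phi>\<close>.\<close>

lemma thinning_mecke:
  assumes \<phi>: "\<phi> \<in> configurations" and u: "u \<in> borel_measurable (borel \<Otimes>\<^sub>M config_space)"
  shows "(\<integral>\<^sup>+\<psi>. \<integral>\<^sup>+x. u (x, remove_atom \<psi> x) \<partial>\<psi> \<partial>thinning_law \<beta> \<phi>) =
    (\<integral>\<^sup>+x. ennreal (\<beta> x) * (\<integral>\<^sup>+\<psi>. u (x, \<psi>) \<partial>thinning_law \<beta> (remove_atom \<phi> x)) \<partial>\<phi>)"
proof -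
  have \<phi>': "\<phi> \<in> space config_space" using \<phi> by (simp add: space_config_space)
  have m: "(\<lambda>x. ennreal (\<beta> x) * (\<integral>\<^sup>+\<psi>. u (x, \<psi>) \<partial>thinning_law \<beta> (remove_atom \<phi> x))) \<in> borel_measurable borel"
    using measurable_compose[OF measurable_Pair[OF measurable_ident_sets[OF refl] remove_atom_measurable[OF measurable_ident_sets[OF refl] measurable_const[OF \<phi>']]]
        nn_integral_thinning_law_measurable[OF u]] by simp
  have "(\<integral>\<^sup>+\<psi>. \<integral>\<^sup>+x. u (x, remove_atom \<psi> x) \<partial>\<psi> \<partial>thinning_law \<beta> \<phi>) =
      (\<integral>\<^sup>+p. ennreal (\<beta> (fst p)) * (\<integral>\<^sup>+\<psi>. u (fst p, \<psi>) \<partial>labelled_thinning (points \<phi> - {p})) \<partial>count_space (points \<phi>))"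
    unfolding thinning_law_eq by (rule labelled_thinning_mecke[OF locally_finite_points[OF \<phi>] u])
  also have "\<dots> = (\<integral>\<^sup>+p. ennreal (\<beta> (fst p)) * (\<integral>\<^sup>+\<psi>. u (fst p, \<psi>) \<partial>thinning_law \<beta> (remove_atom \<phi> (fst p))) \<partial>count_space (points \<phi>))"
    by (intro nn_integral_cong) (simp add: labelled_thinning_remove[OF \<phi>])
  also have "\<dots> = (\<integral>\<^sup>+x. ennreal (\<beta> x) * (\<integral>\<^sup>+\<psi>. u (x, \<psi>) \<partial>thinning_law \<beta> (remove_atom \<phi> x)) \<partial>\<phi>)"
    using nn_integral_labelled_config[OF m, of "points \<phi>"] by (simp add: labelled_config_points[OF \<phi>])
  finally show ?thesis .
qed

text \<open>\<open>is_thinning\<close> prescribes the joint law of \<open>(\<Phi>, \<Psi>)\<close>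
  on product sets only. These form a generating pi-system, so the joint law is the mixture of the
  kernels \<open>?k\<close>, and integrals of any \<open>F\<close> follow.\<close>

lemma nn_integral_thinning:
  assumes \<Phi>: "\<Phi> \<in> M \<rightarrow>\<^sub>M config_space" and th: "is_thinning M \<beta> \<Phi> \<Psi>"
    and F: "F \<in> borel_measurable (config_space \<Otimes>\<^sub>M config_space)"
  shows "(\<integral>\<^sup>+\<omega>. F (\<Phi> \<omega>, \<Psi> \<omega>) \<partial>M) = (\<integral>\<^sup>+\<omega>. \<integral>\<^sup>+\<psi>. F (\<Phi> \<omega>, \<psi>) \<partial>thinning_law \<beta> (\<Phi> \<omega>) \<partial>M)"
proof -
  interpret prob_space M using th by (simp add: is_thinning_def point_process_def)
  have \<Psi>: "\<Psi> \<in> M \<rightarrow>\<^sub>M config_space" using th by (simp add: is_thinning_def point_process_def)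
  let ?C = "config_space :: 'a measure measure"
  note [measurable] = \<Phi> \<Psi>
  let ?k = "\<lambda>\<omega>. distr (thinning_law \<beta> (\<Phi> \<omega>)) (?C \<Otimes>\<^sub>M ?C) (Pair (\<Phi> \<omega>))"
  have k: "?k \<in> M \<rightarrow>\<^sub>M subprob_algebra (?C \<Otimes>\<^sub>M ?C)"
    by (rule measurable_distr2[where M="?C"]) measurable
  have pair: "Pair (\<Phi> \<omega>) \<in> thinning_law \<beta> (\<Phi> \<omega>) \<rightarrow>\<^sub>M ?C \<Otimes>\<^sub>M ?C" if [measurable]: "\<omega> \<in> space M" for \<omega>
    by measurable
  let ?L = "distr M (?C \<Otimes>\<^sub>M ?C) (\<lambda>\<omega>. (\<Phi> \<omega>, \<Psi> \<omega>))"
  have "?L = M \<bind> ?k"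
  proof (rule measure_eqI_generator_eq[OF Int_stable_pair_measure_generator[of ?C ?C] pair_measure_closed])
    show "sets ?L = sigma_sets (space ?C \<times> space ?C) {a \<times> b |a b. a \<in> sets ?C \<and> b \<in> sets ?C}"
      by (simp add: sets_pair_measure)
    show "sets (M \<bind> ?k) = sigma_sets (space ?C \<times> space ?C) {a \<times> b |a b. a \<in> sets ?C \<and> b \<in> sets ?C}"
      using sets_bind[OF sets_kernel[OF k] not_empty] by (simp add: sets_pair_measure)
    show "range (\<lambda>_::nat. space ?C \<times> space ?C) \<subseteq> {a \<times> b |a b. a \<in> sets ?C \<and> b \<in> sets ?C}" by auto
    show "emeasure ?L (space ?C \<times> space ?C) \<noteq> \<infinity>"
      by (subst emeasure_distr) (auto simp: emeasure_eq_measure)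
    fix X assume "X \<in> {a \<times> b |a b. a \<in> sets ?C \<and> b \<in> sets ?C}"
    then obtain D B where X: "X = D \<times> B" and D[measurable]: "D \<in> sets ?C" and B[measurable]: "B \<in> sets ?C" by auto
    have "emeasure ?L X = emeasure M {\<omega>\<in>space M. \<Phi> \<omega> \<in> D \<and> \<Psi> \<omega> \<in> B}"
      by (subst emeasure_distr) (auto simp: X intro!: arg_cong[where f="emeasure M"])
    also have "\<dots> = (\<integral>\<^sup>+\<omega>. indicator D (\<Phi> \<omega>) * emeasure (thinning_law \<beta> (\<Phi> \<omega>)) B \<partial>M)"
      using th D B by (simp add: is_thinning_def)
    also have "\<dots> = (\<integral>\<^sup>+\<omega>. emeasure (?k \<omega>) X \<partial>M)"
    proof (rule nn_integral_cong)
      fix \<omega> assume \<omega>: "\<omega> \<in> space M"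
      have sp: "space (thinning_law \<beta> (\<Phi> \<omega>)) = space ?C" by (rule sets_eq_imp_space_eq) simp
      have "emeasure (?k \<omega>) X = emeasure (thinning_law \<beta> (\<Phi> \<omega>)) (Pair (\<Phi> \<omega>) -` X \<inter> space ?C)"
        using emeasure_distr[OF pair[OF \<omega>], of X] by (simp add: X sp)
      also have "Pair (\<Phi> \<omega>) -` X \<inter> space ?C = (if \<Phi> \<omega> \<in> D then B else {})"
        using sets.sets_into_space[OF B] by (auto simp: X)
      finally show "indicator D (\<Phi> \<omega>) * emeasure (thinning_law \<beta> (\<Phi> \<omega>)) B = emeasure (?k \<omega>) X"
        by simp
    qed
    also have "\<dots> = emeasure (M \<bind> ?k) X"
      by (rule emeasure_bind[OF not_empty k, symmetric]) (simp add: X)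
    finally show "emeasure ?L X = emeasure (M \<bind> ?k) X" .
  qed (auto simp: pair_measure_closed)
  moreover have "(\<integral>\<^sup>+\<omega>. F (\<Phi> \<omega>, \<Psi> \<omega>) \<partial>M) = (\<integral>\<^sup>+z. F z \<partial>?L)"
    by (subst nn_integral_distr) (use F in auto)
  moreover have "(\<integral>\<^sup>+z. F z \<partial>(M \<bind> ?k)) = (\<integral>\<^sup>+\<omega>. \<integral>\<^sup>+z. F z \<partial>?k \<omega> \<partial>M)"
    by (rule nn_integral_bind[OF F k])
  moreover have "(\<integral>\<^sup>+\<omega>. \<integral>\<^sup>+z. F z \<partial>?k \<omega> \<partial>M) = (\<integral>\<^sup>+\<omega>. \<integral>\<^sup>+\<psi>. F (\<Phi> \<omega>, \<psi>) \<partial>thinning_law \<beta> (\<Phi> \<omega>) \<partial>M)"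
    by (intro nn_integral_cong nn_integral_distr pair) (use F in auto)
  ultimately show ?thesis by simp
qed

text \<open>The disintegration is used twice: forwards, to pass from a sum over
  \<open>\<Psi>\<close> to one over \<open>\<Phi>\<close>; and backwards, after the equation for
  \<open>c\<close>, to bring \<open>\<Psi>\<close> back beside \<open>c x (\<Phi> \<omega>)\<close>,
  where conditioning on \<open>\<Psi>\<close> applies.\<close>

lemma papangelou_equation_thinning:
  assumes l: "sets l = sets borel"
    and \<Phi>: "point_process M \<Phi>" and th: "is_thinning M \<beta> \<Phi> \<Psi>"
    and c: "papangelou_intensity M l \<Phi> c"
    and g: "joint_version M \<Phi> \<Psi> config_space borel (\<lambda>(x, \<phi>). c x \<phi>) g"
    and u: "u \<in> borel_measurable (borel \<Otimes>\<^sub>M config_space)"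
  shows "(\<integral>\<^sup>+\<omega>. (\<integral>\<^sup>+x. u (x, remove_point (\<Psi> \<omega>) x) \<partial>\<Psi> \<omega>) \<partial>M) =
    (\<integral>\<^sup>+x. (\<integral>\<^sup>+\<omega>. ennreal (\<beta> x) * g (x, \<Psi> \<omega>) * u (x, \<Psi> \<omega>) \<partial>M) \<partial>l)"
proof -
  interpret prob_space M using \<Phi> by (simp add: point_process_def)
  have M: "prob_space M" by (rule prob_space_axioms)
  have \<Phi>m: "\<Phi> \<in> M \<rightarrow>\<^sub>M config_space" using \<Phi> by (simp add: point_process_def)
  have \<Psi>m: "\<Psi> \<in> M \<rightarrow>\<^sub>M config_space" using th by (simp add: is_thinning_def point_process_def)
  have conf: "\<Phi> \<omega> \<in> configurations" "\<Psi> \<omega> \<in> configurations" if "\<omega> \<in> space M" for \<omega>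
    using measurable_space[OF \<Phi>m that] measurable_space[OF \<Psi>m that] by (auto simp: space_config_space)
  note [measurable] = \<Phi>m \<Psi>m u
  have cm[measurable]: "(\<lambda>(x, \<phi>). c x \<phi>) \<in> borel_measurable (borel \<Otimes>\<^sub>M config_space)"
    using c by (simp add: papangelou_intensity_def)
  have gm[measurable]: "g \<in> borel_measurable (borel \<Otimes>\<^sub>M config_space)"
    using g by (simp add: joint_version_def[OF M \<Phi>m \<Psi>m])
  define f where "f \<psi> = (\<integral>\<^sup>+x. u (x, remove_atom \<psi> x) \<partial>\<psi>)" for \<psi>
  have fm[measurable]: "f \<in> borel_measurable config_space"
    unfolding f_def by (rule nn_integral_remove_atom_measurable[OF u])
  define v where "v z = (case z of (x, \<phi>) \<Rightarrow> ennreal (\<beta> x) * (\<integral>\<^sup>+\<psi>. u (x, \<psi>) \<partial>thinning_law \<beta> \<phi>))" for z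
  have vm: "v \<in> borel_measurable (borel \<Otimes>\<^sub>M config_space)"
    using nn_integral_thinning_law_measurable[OF u] by (simp add: v_def[abs_def])
  have "(\<integral>\<^sup>+\<omega>. (\<integral>\<^sup>+x. u (x, remove_point (\<Psi> \<omega>) x) \<partial>\<Psi> \<omega>) \<partial>M) = (\<integral>\<^sup>+\<omega>. f (\<Psi> \<omega>) \<partial>M)"
    unfolding f_def by (intro nn_integral_cong nn_integral_remove_point conf)
  also have "\<dots> = (\<integral>\<^sup>+\<omega>. \<integral>\<^sup>+\<psi>. f \<psi> \<partial>thinning_law \<beta> (\<Phi> \<omega>) \<partial>M)"
    using nn_integral_thinning[OF \<Phi>m th, of "\<lambda>z. f (snd z)"] by simp
  also have "\<dots> = (\<integral>\<^sup>+\<omega>. \<integral>\<^sup>+x. v (x, remove_atom (\<Phi> \<omega>) x) \<partial>\<Phi> \<omega> \<partial>M)"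
    unfolding f_def v_def split by (intro nn_integral_cong thinning_mecke u conf)
  also have "\<dots> = (\<integral>\<^sup>+\<omega>. \<integral>\<^sup>+x. v (x, remove_point (\<Phi> \<omega>) x) \<partial>\<Phi> \<omega> \<partial>M)"
    by (intro nn_integral_cong nn_integral_remove_point[symmetric] conf)
  also have "\<dots> = (\<integral>\<^sup>+x. (\<integral>\<^sup>+\<omega>. c x (\<Phi> \<omega>) * v (x, \<Phi> \<omega>) \<partial>M) \<partial>l)"
    using c vm by (simp add: papangelou_intensity_def)
  also have "\<dots> = (\<integral>\<^sup>+x. (\<integral>\<^sup>+\<omega>. ennreal (\<beta> x) * g (x, \<Psi> \<omega>) * u (x, \<Psi> \<omega>) \<partial>M) \<partial>l)"
  proof (rule nn_integral_cong)
    fix x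
    have up[measurable]: "(\<lambda>\<psi>. u (x, \<psi>)) \<in> borel_measurable config_space"
      and cp[measurable]: "c x \<in> borel_measurable config_space"
      and gp[measurable]: "(\<lambda>\<psi>. g (x, \<psi>)) \<in> borel_measurable config_space"
      using u cm gm by measurable
    have "(\<integral>\<^sup>+\<omega>. c x (\<Phi> \<omega>) * v (x, \<Phi> \<omega>) \<partial>M) =
        (\<integral>\<^sup>+\<omega>. \<integral>\<^sup>+\<psi>. c x (\<Phi> \<omega>) * ennreal (\<beta> x) * u (x, \<psi>) \<partial>thinning_law \<beta> (\<Phi> \<omega>) \<partial>M)"
      unfolding v_def split by (intro nn_integral_cong) (simp add: nn_integral_cmult mult.assoc)
    also have "\<dots> = (\<integral>\<^sup>+\<omega>. c x (\<Phi> \<omega>) * ennreal (\<beta> x) * u (x, \<Psi> \<omega>) \<partial>M)"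
      using nn_integral_thinning[OF \<Phi>m th, of "\<lambda>z. c x (fst z) * ennreal (\<beta> x) * u (x, snd z)"] by simp
    also have "\<dots> = ennreal (\<beta> x) * (\<integral>\<^sup>+\<omega>. u (x, \<Psi> \<omega>) * c x (\<Phi> \<omega>) \<partial>M)"
      by (subst nn_integral_cmult[symmetric]) (auto simp: ac_simps)
    \<comment> \<open>For fixed \<open>x\<close> the weight \<open>u (x, \<Psi> \<omega>)\<close>
      depends on \<open>\<Psi>\<close> alone, so \<open>c\<close> may be replaced by its conditional
      version.\<close>
    also have "(\<integral>\<^sup>+\<omega>. u (x, \<Psi> \<omega>) * c x (\<Phi> \<omega>) \<partial>M) = (\<integral>\<^sup>+\<omega>. u (x, \<Psi> \<omega>) * g (x, \<Psi> \<omega>) \<partial>M)"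
      using joint_version_integral[OF M \<Phi>m \<Psi>m g _ cm up, of x] by simp
    also have "ennreal (\<beta> x) * \<dots> = (\<integral>\<^sup>+\<omega>. ennreal (\<beta> x) * g (x, \<Psi> \<omega>) * u (x, \<Psi> \<omega>) \<partial>M)"
      by (subst nn_integral_cmult[symmetric]) (auto simp: ac_simps)
    finally show "(\<integral>\<^sup>+\<omega>. c x (\<Phi> \<omega>) * v (x, \<Phi> \<omega>) \<partial>M) =
      (\<integral>\<^sup>+\<omega>. ennreal (\<beta> x) * g (x, \<Psi> \<omega>) * u (x, \<Psi> \<omega>) \<partial>M)" .
  qed
  finally show ?thesis .
qed

end

section \<open>Finiteness forced by the Papangelou equation\<close>

context exhaustion
begin

text \<open>The reduced Campbell measure is finite on \<open>K n \<times> {\<psi>. \<psi> (K n) \<le> m}\<close>.\<close>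

lemma papangelou_equation_imp_finite:
  fixes c :: "'a \<Rightarrow> 'a measure \<Rightarrow> ennreal"
  assumes l: "sets l = sets borel" and \<Psi>: "point_process M \<Psi>"
    and cm: "(\<lambda>(x, \<phi>). c x \<phi>) \<in> borel_measurable (borel \<Otimes>\<^sub>M config_space)"
    and eq: "\<And>u. u \<in> borel_measurable (borel \<Otimes>\<^sub>M config_space) \<Longrightarrow>
        (\<integral>\<^sup>+\<omega>. (\<integral>\<^sup>+x. u (x, remove_point (\<Psi> \<omega>) x) \<partial>\<Psi> \<omega>) \<partial>M) =
        (\<integral>\<^sup>+x. (\<integral>\<^sup>+\<omega>. c x (\<Psi> \<omega>) * u (x, \<Psi> \<omega>) \<partial>M) \<partial>l)"
  shows "AE x in l. AE \<omega> in M. c x (\<Psi> \<omega>) < \<infinity>"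
proof -
  interpret prob_space M using \<Psi> by (simp add: point_process_def)
  have \<Psi>m[measurable]: "\<Psi> \<in> M \<rightarrow>\<^sub>M config_space" using \<Psi> by (simp add: point_process_def)
  have conf: "\<Psi> \<omega> \<in> configurations" if "\<omega> \<in> space M" for \<omega>
    using measurable_space[OF \<Psi>m that] by (auto simp: space_config_space)
  note [measurable] = cm
  note [measurable_cong] = l
  define u where "u n m z = (indicator (K n) (fst z) * of_bool (emeasure (snd z) (K n) \<le> of_nat m) :: ennreal)"
    for n m :: nat and z :: "'a \<times> 'a measure"
  have um[measurable]: "u n m \<in> borel_measurable (borel \<Otimes>\<^sub>M config_space)" for n m
    unfolding u_def by measurable
  have u_bound: "(\<integral>\<^sup>+x. u n m (x, remove_point \<psi> x) \<partial>\<psi>) \<le> of_nat (Suc m)" if \<psi>: "\<psi> \<in> configurations" for n m \<psi>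
  proof -
    note [measurable_cong] = sets_configuration[OF \<psi>]
    have "(\<integral>\<^sup>+x. u n m (x, remove_point \<psi> x) \<partial>\<psi>) \<le>
        (\<integral>\<^sup>+x. of_bool (emeasure \<psi> (K n) \<le> of_nat (Suc m)) * indicator (K n) x \<partial>\<psi>)"
    proof (rule nn_integral_mono_AE)
      show "AE x in \<psi>. u n m (x, remove_point \<psi> x) \<le>
          of_bool (emeasure \<psi> (K n) \<le> of_nat (Suc m)) * indicator (K n) x"
        using non_atoms_null[OF \<psi>]
      proof eventually_elim
        case (elim x)
        \<comment> \<open>Removing \<open>x\<close> from \<open>K n\<close> lowers the count by one,
          so a bound \<open>m\<close> after removal is a bound \<open>m + 1\<close> before
          it.\<close>
        have "emeasure \<psi> (K n) \<le> of_nat (Suc m)" if "x \<in> K n" "emeasure (remove_point \<psi> x) (K n) \<le> of_nat m"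
        proof -
          have "emeasure \<psi> (K n) - 1 \<le> of_nat m"
            using that emeasure_remove_point(2)[OF \<psi> elim, of "K n"] by simp
          then show ?thesis by (simp add: ennreal_minus_le_iff add.commute)
        qed
        then show ?case by (auto simp: u_def indicator_def)
      qed
    qed
    also have "\<dots> = of_bool (emeasure \<psi> (K n) \<le> of_nat (Suc m)) * emeasure \<psi> (K n)"
      by (subst nn_integral_cmult_indicator) auto
    also have "\<dots> \<le> of_nat (Suc m)" by (auto simp: of_bool_def simp del: of_nat_Suc)
    finally show ?thesis .
  qed
  have "AE x in l. AE \<omega> in M. c x (\<Psi> \<omega>) * u n m (x, \<Psi> \<omega>) < \<infinity>" for n m
  proof -
    have "(\<integral>\<^sup>+x. (\<integral>\<^sup>+\<omega>. c x (\<Psi> \<omega>) * u n m (x, \<Psi> \<omega>) \<partial>M) \<partial>l) \<le> (\<integral>\<^sup>+\<omega>. of_nat (Suc m) \<partial>M)"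
      unfolding eq[OF um, symmetric] by (intro nn_integral_mono u_bound conf)
    also have "\<dots> < \<infinity>" by (simp add: emeasure_space_1 of_nat_less_top del: of_nat_Suc)
    finally have fin: "(\<integral>\<^sup>+x. (\<integral>\<^sup>+\<omega>. c x (\<Psi> \<omega>) * u n m (x, \<Psi> \<omega>) \<partial>M) \<partial>l) \<noteq> \<infinity>" by auto
    have "(\<lambda>x. \<integral>\<^sup>+\<omega>. c x (\<Psi> \<omega>) * u n m (x, \<Psi> \<omega>) \<partial>M) \<in> borel_measurable l"
      by measurable
    then have "AE x in l. (\<integral>\<^sup>+\<omega>. c x (\<Psi> \<omega>) * u n m (x, \<Psi> \<omega>) \<partial>M) \<noteq> \<infinity>"
      using fin by (rule nn_integral_PInf_AE)
    then show ?thesis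
    proof eventually_elim
      case (elim x)
      have "(\<lambda>\<omega>. c x (\<Psi> \<omega>) * u n m (x, \<Psi> \<omega>)) \<in> borel_measurable M" by measurable
      from nn_integral_PInf_AE[OF this elim] show ?case
        by (auto simp: less_top)
    qed
  qed
  then have "AE x in l. \<forall>n m. AE \<omega> in M. c x (\<Psi> \<omega>) * u n m (x, \<Psi> \<omega>) < \<infinity>"
    by (simp add: AE_all_countable)
  then show ?thesis
  proof eventually_elim
    case (elim x)
    obtain n where n: "x \<in> K n" using in_K by blast
    have "AE \<omega> in M. \<forall>m. c x (\<Psi> \<omega>) * u n m (x, \<Psi> \<omega>) < \<infinity>"
      using elim by (simp add: AE_all_countable)
    then show ?case
    proof (rule AE_mp, intro AE_I2 impI)
      fix \<omega> assume \<omega>: "\<omega> \<in> space M" and fin: "\<forall>m. c x (\<Psi> \<omega>) * u n m (x, \<Psi> \<omega>) < \<infinity>"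
      obtain m :: nat where "emeasure (\<Psi> \<omega>) (K n) = of_nat m"
        using configuration_nat[OF conf[OF \<omega>] K_relatively_compact] by blast
      with n have "u n m (x, \<Psi> \<omega>) = 1" by (simp add: u_def)
      with fin show "c x (\<Psi> \<omega>) < \<infinity>" by (metis mult.right_neutral)
    qed
  qed
qed

end

theorem theorem4p7:
  fixes l :: "'a::{metric_space, second_countable_topology} measure"
    and M :: "'w measure"
    and \<Phi> \<Psi> :: "'w \<Rightarrow> 'a measure"
    and c :: "'a \<Rightarrow> 'a measure \<Rightarrow> ennreal"
    and \<beta> :: "'a \<Rightarrow> real"
  assumes "locally compact (UNIV :: 'a set)"
    and "radon_measure l"
    and "point_process M \<Phi>"
    and "papangelou_intensity M l \<Phi> c"
    and "\<beta> \<in> borel_measurable borel"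
    and "\<And>x. 0 \<le> \<beta> x \<and> \<beta> x \<le> 1"
    and "is_thinning M \<beta> \<Phi> \<Psi>"
  shows "\<exists>c\<^sub>\<beta>. papangelou_intensity M l \<Psi> c\<^sub>\<beta> \<and>
    (\<forall>x. AE \<omega> in M. c\<^sub>\<beta> x (\<Psi> \<omega>) =
       ennreal (\<beta> x) *
       nn_cond_exp M (vimage_algebra (space M) \<Psi> config_space) (\<lambda>\<omega>. c x (\<Phi> \<omega>)) \<omega>)"
proof -
  obtain K :: "nat \<Rightarrow> 'a set" where "exhaustion K"
    using exhaustion_exists[OF assms(1)] by blast
  then interpret thinning K \<beta>
    using assms(5,6) by (simp add: thinning_def thinning_axioms_def)
  have l: "sets l = sets borel" using assms(2) by (simp add: radon_measure_def)
  have M: "prob_space M" and \<Phi>m: "\<Phi> \<in> M \<rightarrow>\<^sub>M config_space"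
    using assms(3) by (simp_all add: point_process_def)
  have \<Psi>: "point_process M \<Psi>" using assms(7) by (simp add: is_thinning_def)
  then have \<Psi>m: "\<Psi> \<in> M \<rightarrow>\<^sub>M config_space" by (simp add: point_process_def)
  have "(\<lambda>(x, \<phi>). c x \<phi>) \<in> borel_measurable (borel \<Otimes>\<^sub>M config_space)"
    using assms(4) by (simp add: papangelou_intensity_def)
  from joint_version_exists[OF M \<Phi>m \<Psi>m this]
  obtain g where g: "joint_version M \<Phi> \<Psi> config_space borel (\<lambda>(x, \<phi>). c x \<phi>) g" by blast
  then have gm[measurable]: "g \<in> borel_measurable (borel \<Otimes>\<^sub>M config_space)"
    by (simp add: joint_version_def[OF M \<Phi>m \<Psi>m])
  define c\<^sub>\<beta> where "c\<^sub>\<beta> x \<psi> = ennreal (\<beta> x) * g (x, \<psi>)" for x \<psi>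
  have cm: "(\<lambda>(x, \<phi>). c\<^sub>\<beta> x \<phi>) \<in> borel_measurable (borel \<Otimes>\<^sub>M config_space)"
    unfolding c\<^sub>\<beta>_def by measurable
  have eq: "(\<integral>\<^sup>+\<omega>. (\<integral>\<^sup>+x. u (x, remove_point (\<Psi> \<omega>) x) \<partial>\<Psi> \<omega>) \<partial>M) =
      (\<integral>\<^sup>+x. (\<integral>\<^sup>+\<omega>. c\<^sub>\<beta> x (\<Psi> \<omega>) * u (x, \<Psi> \<omega>) \<partial>M) \<partial>l)"
    if "u \<in> borel_measurable (borel \<Otimes>\<^sub>M config_space)" for u
    unfolding c\<^sub>\<beta>_def by (rule papangelou_equation_thinning[OF l assms(3,7,4) g that])
  have "papangelou_intensity M l \<Psi> c\<^sub>\<beta>"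
    unfolding papangelou_intensity_def
    using cm eq papangelou_equation_imp_finite[OF l \<Psi> cm eq] by blast
  \<comment> \<open>This holds at every \<open>x\<close>, not just almost every one, because
    \<open>joint_version\<close> asks for a version at each point of the space.\<close>
  moreover have "AE \<omega> in M. c\<^sub>\<beta> x (\<Psi> \<omega>) = ennreal (\<beta> x) *
       nn_cond_exp M (vimage_algebra (space M) \<Psi> config_space) (\<lambda>\<omega>. c x (\<Phi> \<omega>)) \<omega>" for x
  proof -
    have "AE \<omega> in M. g (x, \<Psi> \<omega>) = nn_cond_exp M (vimage_algebra (space M) \<Psi> config_space) (\<lambda>\<omega>. c x (\<Phi> \<omega>)) \<omega>"
      using g by (simp add: joint_version_def[OF M \<Phi>m \<Psi>m])
    then show ?thesis by eventually_elim (simp add: c\<^sub>\<beta>_def)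
  qed
  ultimately show ?thesis by blast
qed

end
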